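(* Let $(V_1,V_2)$ be a pair of commuting isometries on a Hilbert space $\mathcal H$ with $\operatorname{ran}V_1=\operatorname{ran}V_2$ and $\ker(V_1V_2)^*\neq\{0\}$. Let $(\mathcal E,P,U)$ be its BCL triple with associated functions $\varphi_1,\varphi_2$ (in this situation $U(\operatorname{ran}P^\perp)=\operatorname{ran}P$ and $U(\operatorname{ran}P)=\operatorname{ran}P^\perp$). Let $U_1:\operatorname{ran}P^\perp\to\operatorname{ran}P$ and $U_2:\operatorname{ran}P\to\operatorname{ran}P^\perp$ be the unitaries $U_1x=Ux$, $U_2y=Uy$. Then for $z\in\mathbb D$, $$\sigma(\varphi_1(z),\varphi_2(z))=\{\pm\sqrt z\,(e^{-i\theta/2},e^{i\theta/2}):e^{i\theta}\in\sigma(U_1U_2)\},$$ and for every point in this joint spectrum the non-singularity of the Koszul complex breaks at stage 3. Also $$\sigma(M_{\varphi_1},M_{\varphi_2})=\overline{\bigcup_{z\in\mathbb D}\sigma(\varphi_1(z),\varphi_2(z))}=\{z(1,e^{i\theta}):z\in\overline{\mathbb D},\ e^{i\theta}\in\sigma(U_1U_2)\},$$ and for every point $(z_1,z_2)$ in $\{z(1,e^{i\theta}):z\in\mathbb D,\ e^{i\theta}\in\sigma(U_1U_2)\}$ the non-singularity of the Koszul complex of $(M_{\varphi_1}-z_1I,M_{\varphi_2}-z_2I)$ breaks at stage 3.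
   Context: Given a Hilbert space $\mathcal E$, a projection $P$ and unitary $U$ on $\mathcal E$, set $P^\perp=I-P$, $\varphi_1(z)=U^*(P^\perp+zP)$, $\varphi_2(z)=(P+zP^\perp)U$ ($z\in\mathbb D$), and let $M_{\varphi_i}$ be the multiplication operators on the $\mathcal E$-valued Hardy space $H^2_{\mathbb D}(\mathcal E)$. Berger–Coburn–Lebow theorem: for commuting isometries $(V_1,V_2)$ on $\mathcal H$, $\mathcal H=\mathcal H_p\oplus\mathcal H_u$ (jointly reducing), $V_i|_{\mathcal H_u}$ commuting unitaries, and there is a triple $(\mathcal E,P,U)$, unique up to unitary equivalence, with $(V_1|_{\mathcal H_p},V_2|_{\mathcal H_p})$ unitarily equal to $(M_{\varphi_1},M_{\varphi_2})$ ($\mathcal E\cong\ker(V_1V_2)^*$); this is the BCL triple. $\sqrt z$ denotes either square root of $z$. Koszul complex of commuting $T_1,T_2$: $0\to\mathcal H\xrightarrow{\delta_1}\mathcal H\oplus\mathcal H\xrightarrow{\delta_2}\mathcal H\to0$, $\delta_1h=(T_1h,T_2h)$, $\delta_2(h_1,h_2)=T_1h_2-T_2h_1$; $\sigma(T_1,T_2)$ is the Taylor joint spectrum; breaking at stage 3 means $\operatorname{ran}(T_1-\lambda_1)+\operatorname{ran}(T_2-\lambda_2)\ne\mathcal H$. *)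

theory Defs
  imports "HOL-Analysis.Analysis" "HOL-Library.Function_Algebras"
begin

class complex_inner = real_normed_vector +
  fixes scaleC :: "complex \<Rightarrow> 'a \<Rightarrow> 'a" (infixr \<open>*\<^sub>C\<close> 75)
  fixes cinner :: "'a \<Rightarrow> 'a \<Rightarrow> complex"
  assumes scaleC_add_right: "a *\<^sub>C (x + y) = a *\<^sub>C x + a *\<^sub>C y"
    and scaleC_add_left: "(a + b) *\<^sub>C x = a *\<^sub>C x + b *\<^sub>C x"
    and scaleC_scaleC: "a *\<^sub>C (b *\<^sub>C x) = (a * b) *\<^sub>C x"
    and scaleC_one: "1 *\<^sub>C x = x"
    and scaleR_scaleC: "scaleR r x = complex_of_real r *\<^sub>C x"
    and cinner_commute: "cinner x y = cnj (cinner y x)"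
    and cinner_add_left: "cinner (x + y) z = cinner x z + cinner y z"
    and cinner_scaleC_left: "cinner (a *\<^sub>C x) y = cnj a * cinner x y"
    and cinner_self_real: "Im (cinner x x) = 0 \<and> Re (cinner x x) \<ge> 0"
    and cinner_eq_zero_iff: "cinner x x = 0 \<longleftrightarrow> x = 0"
    and norm_eq_sqrt_cinner: "norm x = sqrt (Re (cinner x x))"

class chilbert_space = complex_inner + complete_space

definition clinear_op :: "('a::complex_inner \<Rightarrow> 'b::complex_inner) \<Rightarrow> bool" where
  "clinear_op T \<longleftrightarrow> (\<forall>x y. T (x + y) = T x + T y) \<and> (\<forall>c x. T (c *\<^sub>C x) = c *\<^sub>C T x)"

definition bounded_op :: "('a::complex_inner \<Rightarrow> 'b::complex_inner) \<Rightarrow> bool" where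
  "bounded_op T \<longleftrightarrow> clinear_op T \<and> (\<exists>K. \<forall>x. norm (T x) \<le> K * norm x)"

definition adj :: "('a::chilbert_space \<Rightarrow> 'b::chilbert_space) \<Rightarrow> 'b \<Rightarrow> 'a" where
  "adj T = (\<lambda>y. THE z. \<forall>x. cinner (T x) y = cinner x z)"

definition isometry_op :: "('a::chilbert_space \<Rightarrow> 'a) \<Rightarrow> bool" where
  "isometry_op V \<longleftrightarrow> bounded_op V \<and> (\<forall>x. norm (V x) = norm x)"

definition unitary_op :: "('a::chilbert_space \<Rightarrow> 'a) \<Rightarrow> bool" where
  "unitary_op U \<longleftrightarrow> isometry_op U \<and> surj U"

definition projection_op :: "('a::chilbert_space \<Rightarrow> 'a) \<Rightarrow> bool" where
  "projection_op P \<longleftrightarrow> bounded_op P \<and> P \<circ> P = P \<and> adj P = P"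

definition kernel_op :: "('a::complex_inner \<Rightarrow> 'b::complex_inner) \<Rightarrow> 'a set" where
  "kernel_op T = {x. T x = 0}"

text \<open>Spectrum of an operator \<open>T\<close> acting on a (closed, invariant) subspace \<open>S\<close>:
  the set of \<open>\<lambda>\<close> for which \<open>T - \<lambda>I\<close> is not a bijection of \<open>S\<close> onto itself
  (for bounded operators on closed subspaces this is non-invertibility, by the
  bounded inverse theorem).\<close>
definition op_spectrum :: "'a::chilbert_space set \<Rightarrow> ('a \<Rightarrow> 'a) \<Rightarrow> complex set" where
  "op_spectrum S T = {l. \<not> bij_betw (\<lambda>x. T x - l *\<^sub>C x) S S}"

text \<open>For operators \<open>A1, A2\<close> acting on a space (given as carrier set \<open>S\<close>), the Koszul complex
  \<open>0 \<rightarrow> S \<rightarrow> S \<oplus> S \<rightarrow> S \<rightarrow> 0\<close>, \<open>\<delta>1 h = (A1 h, A2 h)\<close>, \<open>\<delta>2 (h1,h2) = A1 h2 - A2 h1\<close>.\<close>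

definition koszul_exact_1 :: "'a::ab_group_add set \<Rightarrow> ('a \<Rightarrow> 'a) \<Rightarrow> ('a \<Rightarrow> 'a) \<Rightarrow> bool" where
  "koszul_exact_1 S A1 A2 \<longleftrightarrow> (\<forall>h\<in>S. A1 h = 0 \<and> A2 h = 0 \<longrightarrow> h = 0)"

definition koszul_exact_2 :: "'a::ab_group_add set \<Rightarrow> ('a \<Rightarrow> 'a) \<Rightarrow> ('a \<Rightarrow> 'a) \<Rightarrow> bool" where
  "koszul_exact_2 S A1 A2 \<longleftrightarrow>
     (\<forall>h1\<in>S. \<forall>h2\<in>S. A1 h2 - A2 h1 = 0 \<longrightarrow> (\<exists>h\<in>S. h1 = A1 h \<and> h2 = A2 h))"

definition koszul_exact_3 :: "'a::ab_group_add set \<Rightarrow> ('a \<Rightarrow> 'a) \<Rightarrow> ('a \<Rightarrow> 'a) \<Rightarrow> bool" where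
  "koszul_exact_3 S A1 A2 \<longleftrightarrow> {A1 a + A2 b | a b. a \<in> S \<and> b \<in> S} = S"

definition koszul_exact :: "'a::ab_group_add set \<Rightarrow> ('a \<Rightarrow> 'a) \<Rightarrow> ('a \<Rightarrow> 'a) \<Rightarrow> bool" where
  "koszul_exact S A1 A2 \<longleftrightarrow> koszul_exact_1 S A1 A2 \<and> koszul_exact_2 S A1 A2 \<and> koszul_exact_3 S A1 A2"

definition taylor_spectrum ::
  "'a::ab_group_add set \<Rightarrow> (complex \<Rightarrow> 'a \<Rightarrow> 'a) \<Rightarrow> ('a \<Rightarrow> 'a) \<Rightarrow> ('a \<Rightarrow> 'a) \<Rightarrow> (complex \<times> complex) set" where
  "taylor_spectrum S sc T1 T2 =
     {(l1, l2). \<not> koszul_exact S (\<lambda>x. T1 x - sc l1 x) (\<lambda>x. T2 x - sc l2 x)}"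

definition koszul_breaks_3 ::
  "'a::ab_group_add set \<Rightarrow> (complex \<Rightarrow> 'a \<Rightarrow> 'a) \<Rightarrow> ('a \<Rightarrow> 'a) \<Rightarrow> ('a \<Rightarrow> 'a) \<Rightarrow> complex \<times> complex \<Rightarrow> bool" where
  "koszul_breaks_3 S sc T1 T2 l \<longleftrightarrow>
     \<not> koszul_exact_3 S (\<lambda>x. T1 x - sc (fst l) x) (\<lambda>x. T2 x - sc (snd l) x)"

text \<open>Elements of \<open>H\<^sup>2(E)\<close> are represented as functions \<open>complex \<Rightarrow> E\<close> that are given on the
  open unit disc by a power series with square-summable coefficients, and vanish off the disc.\<close>

definition hardy_rep :: "(complex \<Rightarrow> 'e::chilbert_space) \<Rightarrow> (nat \<Rightarrow> 'e) \<Rightarrow> bool" where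
  "hardy_rep f c \<longleftrightarrow> summable (\<lambda>n. (norm (c n))\<^sup>2) \<and>
     (\<forall>z\<in>ball 0 1. (\<lambda>n. (z ^ n) *\<^sub>C c n) sums f z) \<and> (\<forall>z. z \<notin> ball 0 1 \<longrightarrow> f z = 0)"

definition hardy2 :: "(complex \<Rightarrow> 'e::chilbert_space) set" where
  "hardy2 = {f. \<exists>c. hardy_rep f c}"

definition hardy_coeffs :: "(complex \<Rightarrow> 'e::chilbert_space) \<Rightarrow> nat \<Rightarrow> 'e" where
  "hardy_coeffs f = (SOME c. hardy_rep f c)"

definition hardy_norm :: "(complex \<Rightarrow> 'e::chilbert_space) \<Rightarrow> real" where
  "hardy_norm f = sqrt (\<Sum>n. (norm (hardy_coeffs f n))\<^sup>2)"

definition hardy_scale :: "complex \<Rightarrow> (complex \<Rightarrow> 'e::chilbert_space) \<Rightarrow> complex \<Rightarrow> 'e" where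
  "hardy_scale a f = (\<lambda>z. a *\<^sub>C f z)"

definition mult_op :: "(complex \<Rightarrow> 'e \<Rightarrow> 'e) \<Rightarrow> (complex \<Rightarrow> 'e::chilbert_space) \<Rightarrow> complex \<Rightarrow> 'e" where
  "mult_op \<phi> f = (\<lambda>z. if z \<in> ball 0 1 then \<phi> z (f z) else 0)"

definition bcl_phi1 :: "('e::chilbert_space \<Rightarrow> 'e) \<Rightarrow> ('e \<Rightarrow> 'e) \<Rightarrow> complex \<Rightarrow> 'e \<Rightarrow> 'e" where
  "bcl_phi1 P U z = (\<lambda>x. adj U ((x - P x) + z *\<^sub>C P x))"

definition bcl_phi2 :: "('e::chilbert_space \<Rightarrow> 'e) \<Rightarrow> ('e \<Rightarrow> 'e) \<Rightarrow> complex \<Rightarrow> 'e \<Rightarrow> 'e" where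
  "bcl_phi2 P U z = (\<lambda>x. P (U x) + z *\<^sub>C (U x - P (U x)))"

definition closed_subspace :: "'a::chilbert_space set \<Rightarrow> bool" where
  "closed_subspace M \<longleftrightarrow> closed M \<and> 0 \<in> M \<and> (\<forall>x\<in>M. \<forall>y\<in>M. x + y \<in> M) \<and> (\<forall>c. \<forall>x\<in>M. c *\<^sub>C x \<in> M)"

text \<open>\<open>(E,P,U)\<close> is a BCL triple of the commuting isometries \<open>(V1,V2)\<close> on \<open>H\<close>:
  \<open>H = H\<^sub>p \<oplus> H\<^sub>u\<close> (orthogonal, jointly reducing), \<open>V\<^sub>i|H\<^sub>u\<close> unitary, and a unitary
  \<open>W : H\<^sub>p \<rightarrow> H\<^sup>2(E)\<close> intertwining \<open>V\<^sub>i|H\<^sub>p\<close> with \<open>M\<^sub>\<phi>\<^sub>i\<close>.\<close>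
definition bcl_triple ::
  "('h::chilbert_space \<Rightarrow> 'h) \<Rightarrow> ('h \<Rightarrow> 'h) \<Rightarrow> ('e::chilbert_space \<Rightarrow> 'e) \<Rightarrow> ('e \<Rightarrow> 'e) \<Rightarrow> bool" where
  "bcl_triple V1 V2 P U \<longleftrightarrow> projection_op P \<and> unitary_op U \<and>
    (\<exists>Hp Hu (W :: 'h \<Rightarrow> complex \<Rightarrow> 'e).
       closed_subspace Hp \<and> closed_subspace Hu \<and>
       (\<forall>x\<in>Hp. \<forall>y\<in>Hu. cinner x y = 0) \<and> (\<forall>h. \<exists>a\<in>Hp. \<exists>b\<in>Hu. h = a + b) \<and>
       V1 ` Hp \<subseteq> Hp \<and> V2 ` Hp \<subseteq> Hp \<and> V1 ` Hu \<subseteq> Hu \<and> V2 ` Hu \<subseteq> Hu \<and>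
       bij_betw V1 Hu Hu \<and> bij_betw V2 Hu Hu \<and>
       bij_betw W Hp hardy2 \<and>
       (\<forall>x\<in>Hp. \<forall>y\<in>Hp. W (x + y) = W x + W y) \<and>
       (\<forall>c. \<forall>x\<in>Hp. W (c *\<^sub>C x) = hardy_scale c (W x)) \<and>
       (\<forall>x\<in>Hp. hardy_norm (W x) = norm x) \<and>
       (\<forall>x\<in>Hp. W (V1 x) = mult_op (bcl_phi1 P U) (W x)) \<and>
       (\<forall>x\<in>Hp. W (V2 x) = mult_op (bcl_phi2 P U) (W x)))"

end

theory Submission
  imports Defs
begin

text \<open>The ranges of \<open>V\<^sub>1\<close> and \<open>V\<^sub>2\<close> agree exactly when \<open>U\<close> interchanges \<open>ran P\<close> and its complement. Then
  \<open>W = U\<^sup>2\<close> commutes with \<open>P\<close> and \<open>U\<close>, and \<open>\<phi>\<^sub>2(z) = W \<phi>\<^sub>1(z)\<close>, \<open>\<phi>\<^sub>1(z) \<phi>\<^sub>2(z) = z\<close>. If \<open>\<lambda>\<^sub>1 \<lambda>\<^sub>2 \<noteq> z\<close> or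
  \<open>\<lambda>\<^sub>1 W - \<lambda>\<^sub>2\<close> is invertible, then the identity is a combination of \<open>\<phi>\<^sub>1(z) - \<lambda>\<^sub>1\<close> and \<open>\<phi>\<^sub>2(z) - \<lambda>\<^sub>2\<close> with
  coefficients in the commutant, and the Koszul complex is exact. In the remaining case
  \<open>(\<lambda>\<^sub>1, \<lambda>\<^sub>2) = (w, w \<mu>)\<close> with \<open>\<mu> \<in> \<sigma>(W)\<close> and \<open>z = w\<^sup>2 \<mu>\<close>. Approximate eigenvectors \<open>x\<close> of \<open>W\<close> in \<open>ran P\<close>
  yield joint approximate eigenvectors \<open>U x + cnj w x\<close> of the adjoints, which contradict surjectivity at
  stage 3 by uniform boundedness. On the Hardy space the same coefficients act by multiplication, and
  evaluating constant functions at points of the disc reduces non-exactness to the fibres.\<close>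

section \<open>Complex inner product spaces\<close>

text \<open>The operator \<open>U_1 U_2\<close> is the square of \<open>U\<close> on
  \<open>range P\<close>, and \<open>U\<close> carries a lower bound for \<open>W - \<mu>\<close>
  from \<open>range P\<close> over to the complement; so the spectrum on one half of the space
  decides invertibility on all of it. At the point (0, 0) over \<open>z = 0\<close> both
  combinations vanish and no ratio \<open>l2 / l1\<close> singles out \<mu>. That point fits the
  description only because the spectrum of \<open>W\<close> is nonempty, and this is where the
  nontrivial kernel of the adjoint of \<open>V1 \<circ> V2\<close> enters. On the Hardy space
  \<open>1 / (z - l1 * l2)\<close> serves as a coefficient when its pole lies outside the closed
  disc, so the fibre condition \<open>z = l1 * l2\<close> relaxes to
  \<open>|l1 * l2| \<le> 1\<close>. The points with \<open>|w| = 1\<close> belong to no fibre over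
  the open disc and call for a growth estimate along the radius.\<close>

lemma scaleC_zero_left [simp]: "0 *\<^sub>C x = 0"
  using scaleC_add_left[of 0 0 x] by simp

lemma scaleC_zero_right [simp]: "a *\<^sub>C 0 = 0"
  using scaleC_add_right[of a 0 0] by simp

lemma scaleC_minus_left: "(- a) *\<^sub>C x = - (a *\<^sub>C x)"
  using scaleC_add_left[of a "- a" x] by (simp add: eq_neg_iff_add_eq_0 add.commute)

lemma scaleC_minus_right: "a *\<^sub>C (- x) = - (a *\<^sub>C x)"
  using scaleC_add_right[of a x "- x"] by (simp add: eq_neg_iff_add_eq_0 add.commute)

lemma scaleC_diff_left: "(a - b) *\<^sub>C x = a *\<^sub>C x - b *\<^sub>C x"
  using scaleC_add_left[of a "- b" x] by (simp add: scaleC_minus_left)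

lemma scaleC_diff_right: "a *\<^sub>C (x - y) = a *\<^sub>C x - a *\<^sub>C y"
  using scaleC_add_right[of a x "- y"] by (simp add: scaleC_minus_right)

lemmas scaleC_simps = scaleC_add_left scaleC_add_right scaleC_diff_left scaleC_diff_right
  scaleC_minus_left scaleC_minus_right scaleC_scaleC scaleC_one

lemma cinner_add_right: "cinner x (y + z) = cinner x y + cinner x z"
  by (metis cinner_add_left cinner_commute complex_cnj_add)

lemma cinner_scaleC_right: "cinner x (a *\<^sub>C y) = a * cinner x y"
  by (metis cinner_scaleC_left cinner_commute complex_cnj_cnj complex_cnj_mult)

lemma cinner_zero_left [simp]: "cinner 0 x = 0"
  using cinner_add_left[of 0 0 x] by simp

lemma cinner_zero_right [simp]: "cinner x 0 = 0"
  using cinner_add_right[of x 0 0] by simp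

lemma cinner_minus_left: "cinner (- x) y = - cinner x y"
  using cinner_add_left[of x "- x" y] by (simp add: eq_neg_iff_add_eq_0 add.commute)

lemma cinner_minus_right: "cinner x (- y) = - cinner x y"
  using cinner_add_right[of x y "- y"] by (simp add: eq_neg_iff_add_eq_0 add.commute)

lemma cinner_diff_left: "cinner (x - y) z = cinner x z - cinner y z"
  using cinner_add_left[of x "- y" z] by (simp add: cinner_minus_left)

lemma cinner_diff_right: "cinner x (y - z) = cinner x y - cinner x z"
  using cinner_add_right[of x y "- z"] by (simp add: cinner_minus_right)

lemmas cinner_simps = cinner_add_left cinner_add_right cinner_diff_left cinner_diff_right
  cinner_scaleC_left cinner_scaleC_right cinner_minus_left cinner_minus_right

lemma cinner_self: "cinner x x = complex_of_real ((norm x)\<^sup>2)"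
  using cinner_self_real[of x] norm_eq_sqrt_cinner[of x] by (simp add: complex_eq_iff)

lemma norm_square_eq_cinner: "(norm x)\<^sup>2 = Re (cinner x x)"
  by (simp add: cinner_self del: of_real_power)

lemma norm_scaleC: "norm (a *\<^sub>C x) = cmod a * norm (x::'a::complex_inner)"
proof -
  have "(norm (a *\<^sub>C x))\<^sup>2 = Re (cnj a * a * cinner x x)"
    by (simp only: norm_square_eq_cinner cinner_simps mult_ac)
  also have "cnj a * a = complex_of_real ((cmod a)\<^sup>2)"
    by (metis complex_norm_square mult.commute)
  finally have "(norm (a *\<^sub>C x))\<^sup>2 = (cmod a * norm x)\<^sup>2"
    by (simp add: norm_square_eq_cinner power_mult_distrib del: of_real_power)
  then show ?thesis by (simp add: power2_eq_iff_nonneg)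
qed

lemma norm_add_square:
  "(norm (x + y))\<^sup>2 = (norm x)\<^sup>2 + (norm y)\<^sup>2 + 2 * Re (cinner x (y::'a::complex_inner))"
proof -
  have "Re (cinner y x) = Re (cinner x y)"
    by (subst cinner_commute) simp
  then show ?thesis by (simp add: norm_square_eq_cinner cinner_simps)
qed

lemma norm_diff_square:
  "(norm (x - y))\<^sup>2 = (norm x)\<^sup>2 + (norm y)\<^sup>2 - 2 * Re (cinner x (y::'a::complex_inner))"
  using norm_add_square[of x "- y"] by (simp add: cinner_minus_right)

lemma parallelogram:
  "(norm (x + y))\<^sup>2 + (norm (x - y))\<^sup>2 = 2 * (norm x)\<^sup>2 + 2 * (norm (y::'a::complex_inner))\<^sup>2"
  by (simp add: norm_add_square norm_diff_square)

text \<open>Cauchy-Schwarz, from the nonnegative squared norm of \<open>x\<close> minus its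
  projection onto the line of \<open>y\<close>.\<close>

lemma norm_cinner_le: "cmod (cinner x y) \<le> norm x * norm (y::'a::complex_inner)"
proof (cases "y = 0")
  case False
  define a where "a = cinner y x / complex_of_real ((norm y)\<^sup>2)"
  have "cinner x (a *\<^sub>C y) = complex_of_real ((cmod (cinner x y))\<^sup>2 / (norm y)\<^sup>2)"
    unfolding a_def cinner_simps complex_norm_square of_real_divide
    using cinner_commute[of y x] by simp
  moreover have "norm (a *\<^sub>C y) = cmod (cinner x y) / norm y"
    using False cinner_commute[of y x]
    by (simp add: a_def norm_scaleC norm_divide norm_mult power2_eq_square)
  ultimately have "(norm (x - a *\<^sub>C y))\<^sup>2 = (norm x)\<^sup>2 - (cmod (cinner x y))\<^sup>2 / (norm y)\<^sup>2"
    by (simp add: norm_diff_square power_divide)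
  then have "(cmod (cinner x y))\<^sup>2 / (norm y)\<^sup>2 \<le> (norm x)\<^sup>2"
    by (metis diff_ge_0_iff_ge zero_le_power2)
  then have "(cmod (cinner x y))\<^sup>2 \<le> (norm x * norm y)\<^sup>2"
    using False by (simp add: pos_divide_le_eq power_mult_distrib)
  then show ?thesis by (rule power2_le_imp_le) simp
qed simp

lemma bounded_linear_cinner_right: "bounded_linear (cinner (x::'a::complex_inner))"
  by (rule bounded_linear_intro[where K="norm x"])
     (simp_all add: cinner_simps scaleR_scaleC norm_cinner_le scaleR_conv_of_real
       mult.commute[of _ "norm x"])

lemma bounded_linear_scaleC_right: "bounded_linear ((*\<^sub>C) a :: 'a::complex_inner \<Rightarrow> 'a)"
  by (rule bounded_linear_intro[where K="cmod a"])
     (simp_all add: scaleC_simps scaleR_scaleC norm_scaleC mult.commute)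

lemma cinner_eqI:
  assumes "\<And>z. cinner z x = cinner z y"
  shows "x = y"
proof -
  have "cinner (x - y) (x - y) = 0"
    using assms[of "x - y"] by (simp add: cinner_diff_right)
  then show ?thesis by (simp add: cinner_eq_zero_iff)
qed

lemma bounded_op_bounded_linear:
  assumes "bounded_op T"
  shows "bounded_linear T"
proof -
  obtain K where "\<forall>x. norm (T x) \<le> K * norm x"
    using assms by (auto simp: bounded_op_def)
  then show ?thesis
    using assms by (intro bounded_linear_intro[where K=K])
      (simp_all add: bounded_op_def clinear_op_def scaleR_scaleC mult.commute[of _ K])
qed

text \<open>Polarization: norms of sums determine real parts, and replacing \<open>x\<close> by
  \<open>\<i> *\<^sub>C x\<close> turns the imaginary part into a real one.\<close>

lemma isometric_cinner:
  assumes "clinear_op T" and "\<And>x. norm (T x) = norm x"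
  shows "cinner (T x) (T y) = cinner x y"
proof -
  have re: "Re (cinner (T u) (T v)) = Re (cinner u v)" for u v
  proof -
    have "T u + T v = T (u + v)" using assms(1) by (simp add: clinear_op_def)
    then show ?thesis
      using norm_add_square[of "T u" "T v"] norm_add_square[of u v] by (simp add: assms(2))
  qed
  have "Im (cinner a b) = Re (cinner (\<i> *\<^sub>C a) b)" for a b :: 'a
    by (simp add: cinner_simps)
  moreover have "Im (cinner a b) = Re (cinner (\<i> *\<^sub>C a) b)" for a b :: 'b
    by (simp add: cinner_simps)
  ultimately have "Im (cinner (T x) (T y)) = Im (cinner x y)"
    using re[of "\<i> *\<^sub>C x" y] assms(1) by (simp add: clinear_op_def)
  with re show ?thesis by (simp add: complex_eq_iff)
qed

section \<open>Orthogonal projection, adjoints and uniform boundedness\<close>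

instance chilbert_space \<subseteq> banach ..

lemma closed_subspace_add: "closed_subspace M \<Longrightarrow> x \<in> M \<Longrightarrow> y \<in> M \<Longrightarrow> x + y \<in> M"
  and closed_subspace_scaleC: "closed_subspace M \<Longrightarrow> x \<in> M \<Longrightarrow> c *\<^sub>C x \<in> M"
  and closed_subspace_zero: "closed_subspace M \<Longrightarrow> 0 \<in> M"
  by (auto simp: closed_subspace_def)

lemma closed_subspace_diff:
  assumes "closed_subspace M" "x \<in> M" "y \<in> M"
  shows "x - y \<in> M"
  using closed_subspace_add[OF assms(1,2) closed_subspace_scaleC[OF assms(1,3), of "-1"]]
  by (simp add: scaleC_simps)

text \<open>A minimizing sequence for the distance to \<open>v\<close> is Cauchy by the
  parallelogram law, since its midpoints stay in \<open>M\<close>; minimality of the limit forces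
  orthogonality.\<close>

lemma closed_subspace_projection:
  assumes M: "closed_subspace M"
  shows "\<exists>m\<in>M. \<forall>x\<in>M. cinner x (v - m) = 0"
proof -
  define d where "d = Inf ((\<lambda>m. (norm (v - m))\<^sup>2) ` M)"
  have bdd: "bdd_below ((\<lambda>m. (norm (v - m))\<^sup>2) ` M)"
    by (rule bdd_belowI[of _ 0]) auto
  have ne: "(\<lambda>m. (norm (v - m))\<^sup>2) ` M \<noteq> {}"
    using closed_subspace_zero[OF M] by blast
  have d_le: "d \<le> (norm (v - m))\<^sup>2" if "m \<in> M" for m
    unfolding d_def using bdd that by (auto intro: cInf_lower)
  have "\<exists>m\<in>M. (norm (v - m))\<^sup>2 < d + e" if "e > 0" for e
    using cInf_lessD[OF ne, of "d + e"] that by (auto simp: d_def)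
  then have "\<exists>m\<in>M. (norm (v - m))\<^sup>2 < d + inverse (real (Suc n))" for n
    by simp
  then obtain s where s: "\<And>n. s n \<in> M" "\<And>n. (norm (v - s n))\<^sup>2 < d + inverse (real (Suc n))"
    by metis
  have close: "(norm (s i - s j))\<^sup>2 < 2 * inverse (real (Suc i)) + 2 * inverse (real (Suc j))" for i j
  proof -
    have "(1/2) *\<^sub>C (s i + s j) \<in> M"
      using M s(1) closed_subspace_add closed_subspace_scaleC by metis
    then have "d \<le> (norm (v - (1/2) *\<^sub>C (s i + s j)))\<^sup>2" by (rule d_le)
    moreover have "(v - s i) + (v - s j) = 2 *\<^sub>C (v - (1/2) *\<^sub>C (s i + s j))"
      using scaleC_add_left[of 1 1 v] by (simp add: scaleC_simps algebra_simps)
    then have "(norm ((v - s i) + (v - s j)))\<^sup>2 = 4 * (norm (v - (1/2) *\<^sub>C (s i + s j)))\<^sup>2"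
      by (simp add: norm_scaleC power_mult_distrib)
    ultimately show ?thesis
      using parallelogram[of "v - s i" "v - s j"] s(2)[of i] s(2)[of j]
      by (simp add: norm_minus_commute)
  qed
  have "Cauchy s"
  proof (rule metric_CauchyI)
    fix e :: real assume "e > 0"
    then obtain N where N: "inverse (real (Suc N)) < e\<^sup>2 / 4"
      using reals_Archimedean[of "e\<^sup>2/4"] by auto
    have "dist (s i) (s j) < e" if "i \<ge> N" "j \<ge> N" for i j
    proof -
      have "inverse (real (Suc i)) \<le> inverse (real (Suc N))" "inverse (real (Suc j)) \<le> inverse (real (Suc N))"
        using that by (auto intro!: le_imp_inverse_le)
      then have "(norm (s i - s j))\<^sup>2 < e\<^sup>2"
        using close[of i j] N by linarith
      then show ?thesis
        using \<open>e > 0\<close> by (simp add: dist_norm power2_less_imp_less)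
    qed
    then show "\<exists>N. \<forall>i\<ge>N. \<forall>j\<ge>N. dist (s i) (s j) < e" by blast
  qed
  then obtain m where m: "s \<longlonglongrightarrow> m" using Cauchy_convergent convergent_def by metis
  have mM: "m \<in> M"
    using M closed_sequentially[OF _ _ m] s(1) by (auto simp: closed_subspace_def)
  have "(\<lambda>n. (norm (v - s n))\<^sup>2) \<longlonglongrightarrow> (norm (v - m))\<^sup>2"
    by (intro tendsto_intros m)
  moreover have "(\<lambda>n. d + inverse (real (Suc n))) \<longlonglongrightarrow> d"
    using tendsto_add[OF tendsto_const LIMSEQ_inverse_real_of_nat] by simp
  ultimately have dm: "(norm (v - m))\<^sup>2 \<le> d"
    using s(2) by (intro LIMSEQ_le) (auto intro: less_imp_le)
  have "cinner x (v - m) = 0" if x: "x \<in> M" for x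
  proof (cases "x = 0")
    case False
    \<comment> \<open>Moving from \<open>m\<close> by the projection of \<open>v - m\<close> onto
      the line of \<open>x\<close> would lower the squared distance unless the inner product is
      0.\<close>
    define a where "a = cinner x (v - m) / complex_of_real ((norm x)\<^sup>2)"
    have "m + a *\<^sub>C x \<in> M"
      using M x mM closed_subspace_add closed_subspace_scaleC by metis
    from d_le[OF this] dm have "(norm (v - m))\<^sup>2 \<le> (norm ((v - m) - a *\<^sub>C x))\<^sup>2"
      by (simp only: diff_diff_add)
    moreover have "cinner (v - m) (a *\<^sub>C x) = complex_of_real ((cmod (cinner x (v - m)))\<^sup>2 / (norm x)\<^sup>2)"
      unfolding a_def cinner_scaleC_right complex_norm_square of_real_divide
      using cinner_commute[of "v - m" x] by simp
    moreover have "norm (a *\<^sub>C x) = cmod (cinner x (v - m)) / norm x"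
      using False by (simp add: a_def norm_scaleC norm_divide norm_mult power2_eq_square)
    ultimately have "(cmod (cinner x (v - m)))\<^sup>2 / (norm x)\<^sup>2 \<le> 0"
      by (simp add: norm_diff_square[of "v - m"] power_divide)
    then show ?thesis
      using False by (simp add: divide_le_0_iff)
  qed simp
  with mM show ?thesis by blast
qed

text \<open>The kernel has codimension one, so a vector \<open>u\<close> orthogonal to it represents
  \<open>f\<close> up to scale.\<close>

lemma riesz_representation:
  fixes f :: "'a::chilbert_space \<Rightarrow> complex"
  assumes f: "bounded_linear f" and fC: "\<And>c x. f (c *\<^sub>C x) = c * f x"
  obtains z where "\<And>x. f x = cinner z x"
proof (cases "\<forall>x. f x = 0")
  case True
  then show ?thesis using that[of 0] by simp
next
  case False
  interpret f: bounded_linear f by fact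
  from False obtain v where v: "f v \<noteq> 0" by auto
  have M: "closed_subspace {x. f x = 0}"
    unfolding closed_subspace_def
    by (simp add: f.add f.zero fC closed_Collect_eq f.continuous_on continuous_on_id continuous_on_const)
  obtain m where m: "f m = 0" "\<And>x. f x = 0 \<Longrightarrow> cinner x (v - m) = 0"
    using closed_subspace_projection[OF M, of v] by auto
  define u where "u = v - m"
  have fu: "f u \<noteq> 0" using v m(1) by (simp add: u_def f.diff)
  then have u0: "u \<noteq> 0" using f.zero by auto
  have "f x = cinner ((cnj (f u) / complex_of_real ((norm u)\<^sup>2)) *\<^sub>C u) x" for x
  proof -
    have "f (x - (f x / f u) *\<^sub>C u) = 0" using fu by (simp add: f.diff fC)
    then have "cinner (x - (f x / f u) *\<^sub>C u) u = 0" unfolding u_def by (rule m(2))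
    then have "cinner u (x - (f x / f u) *\<^sub>C u) = 0"
      using cinner_commute by (metis complex_cnj_zero)
    then have "cinner u x = (f x / f u) * complex_of_real ((norm u)\<^sup>2)"
      by (simp add: cinner_simps cinner_self)
    then show ?thesis using fu u0 by (simp add: cinner_simps)
  qed
  then show ?thesis by (rule that)
qed

lemma adj_eqI:
  assumes "\<And>x. cinner (T x) y = cinner x z"
  shows "adj T y = z"
  unfolding adj_def
proof (rule the_equality)
  show "\<forall>x. cinner (T x) y = cinner x z" using assms by blast
  show "w = z" if "\<forall>x. cinner (T x) y = cinner x w" for w
    using that assms by (intro cinner_eqI) metis
qed

text \<open>Riesz representation supplies the vector that the definite description in
  \<open>adj\<close> asks for; uniqueness is in \<open>adj_eqI\<close>.\<close>

lemma cinner_adj: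
  assumes "bounded_op T"
  shows "cinner (T x) y = cinner x (adj T y)"
proof -
  have "bounded_linear (\<lambda>x. cinner y (T x))"
    by (rule bounded_linear_compose[OF bounded_linear_cinner_right bounded_op_bounded_linear[OF assms]])
  moreover have "cinner y (T (c *\<^sub>C x)) = c * cinner y (T x)" for c x
    using assms by (simp add: bounded_op_def clinear_op_def cinner_simps)
  ultimately obtain z where z: "\<And>x. cinner y (T x) = cinner z x"
    using riesz_representation by blast
  have "cinner (T x) y = cinner x z" for x
    using z[of x] cinner_commute by metis
  then show ?thesis using adj_eqI[of T y z] by simp
qed

text \<open>Banach-Steinhaus for the functionals \<open>cinner y\<close>: by Baire some
  \<open>F n\<close> contains a ball. It serves both to bound inverses and to refute surjectivity at
  stage 3.\<close>

lemma uniform_boundedness: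
  fixes Y :: "'a::chilbert_space set"
  assumes "\<And>v. \<exists>K. \<forall>y\<in>Y. cmod (cinner y v) \<le> K"
  obtains K where "\<And>y. y \<in> Y \<Longrightarrow> norm y \<le> K"
proof -
  define F where "F n = {v. \<forall>y\<in>Y. cmod (cinner y v) \<le> real n}" for n
  have cl: "closed (F n)" for n
  proof -
    have "F n = (\<Inter>y\<in>Y. {v. cmod (cinner y v) \<le> real n})" by (auto simp: F_def)
    moreover have "closed {v. cmod (cinner y v) \<le> real n}" for y
      by (intro closed_Collect_le continuous_intros
          bounded_linear.continuous_on[OF bounded_linear_cinner_right])
    ultimately show ?thesis by auto
  qed
  have "\<exists>n. interior (F n) \<noteq> {}"
  proof (rule ccontr)
    assume "\<not> ?thesis"
    then have "Met_TC.mtopology interior_of \<Union>(range F) = {}"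
      using cl by (intro Met_TC.metric_Baire_category_alt) (auto simp: complete_UNIV)
    moreover have "\<Union>(range F) = UNIV"
    proof -
      have "v \<in> \<Union>(range F)" for v
      proof -
        obtain K where "\<forall>y\<in>Y. cmod (cinner y v) \<le> K" using assms by blast
        moreover obtain n where "K \<le> real n" using real_arch_simple by blast
        ultimately have "v \<in> F n" by (force simp: F_def)
        then show ?thesis by blast
      qed
      then show ?thesis by auto
    qed
    ultimately show False by simp
  qed
  then obtain n v0 where "v0 \<in> interior (F n)" by blast
  then obtain r where r: "r > 0" "ball v0 r \<subseteq> F n"
    using mem_interior by blast
  have "norm y \<le> 4 * real n / r" if y: "y \<in> Y" for y
  proof (cases "y = 0")
    case False
    \<comment> \<open>Half the radius in the direction of \<open>y\<close>, so that
      \<open>v0 + w\<close> stays in the ball.\<close>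
    define w where "w = complex_of_real (r / (2 * norm y)) *\<^sub>C y"
    have nw: "norm w = r / 2" using False r(1) by (simp add: w_def norm_scaleC norm_divide)
    have "v0 + w \<in> F n" "v0 \<in> F n" using r nw by (auto simp: dist_norm)
    then have "cmod (cinner y (v0 + w)) \<le> real n" "cmod (cinner y v0) \<le> real n"
      using y by (auto simp: F_def)
    moreover have "cinner y w = cinner y (v0 + w) - cinner y v0" by (simp add: cinner_simps)
    ultimately have "cmod (cinner y w) \<le> 2 * real n"
      using norm_triangle_ineq4[of "cinner y (v0 + w)" "cinner y v0"] by simp
    moreover have "cinner y w = complex_of_real (r * norm y / 2)"
      using False by (simp add: w_def cinner_simps cinner_self power2_eq_square)
    ultimately have "r * norm y / 2 \<le> 2 * real n"
      using r(1) by (simp add: norm_mult norm_divide)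
    then show ?thesis using r(1) by (simp add: field_simps)
  qed (use r in auto)
  then show ?thesis by (rule that)
qed

section \<open>The spectrum of an isometry on a reducing subspace\<close>

lemma isometry_op_simps:
  assumes "isometry_op V"
  shows "V (x + y) = V x + V y" "V (c *\<^sub>C x) = c *\<^sub>C V x" "V (x - y) = V x - V y"
    "V 0 = 0" "norm (V x) = norm x" "cinner (V x) (V y) = cinner x y"
proof -
  have V: "bounded_op V" "clinear_op V" "\<And>x. norm (V x) = norm x"
    using assms unfolding isometry_op_def bounded_op_def by blast+
  interpret bounded_linear V using V(1) by (rule bounded_op_bounded_linear)
  show "V (x + y) = V x + V y" "V (c *\<^sub>C x) = c *\<^sub>C V x" "V (x - y) = V x - V y"
    "V 0 = 0" "norm (V x) = norm x" "cinner (V x) (V y) = cinner x y"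
    using V(2,3) isometric_cinner[OF V(2,3)] by (auto simp: clinear_op_def diff add zero)
qed

lemma isometry_op_bounded_linear: "isometry_op V \<Longrightarrow> bounded_linear V"
  by (simp add: isometry_op_def bounded_op_bounded_linear)

lemma isometry_op_compose:
  assumes "isometry_op V" "isometry_op W"
  shows "isometry_op (\<lambda>x. V (W x))"
proof -
  have "\<exists>K. \<forall>x. norm (V (W x)) \<le> K * norm x"
    by (rule exI[of _ 1]) (simp add: isometry_op_simps assms)
  then show ?thesis
    unfolding isometry_op_def bounded_op_def clinear_op_def by (simp add: isometry_op_simps assms)
qed

text \<open>Both squares expand to
  \<open>(1 + |\<mu>|^2) |u|^2 - 2 Re (\<mu> * cinner (V u) u)\<close>. This replaces normality of
  \<open>V - \<mu>\<close>.\<close>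

lemma norm_isometry_minus_scalar:
  assumes "isometry_op V"
  shows "norm (u - cnj \<mu> *\<^sub>C V u) = norm (V u - \<mu> *\<^sub>C u)"
proof -
  have "Re (cnj \<mu> * cinner u (V u)) = Re (\<mu> * cinner (V u) u)"
    by (subst cinner_commute) simp
  then have "(norm (u - cnj \<mu> *\<^sub>C V u))\<^sup>2 = (norm (V u - \<mu> *\<^sub>C u))\<^sup>2"
    by (simp add: norm_diff_square norm_scaleC cinner_scaleC_right power_mult_distrib
        isometry_op_simps[OF assms])
  then show ?thesis by (simp add: power2_eq_iff_nonneg)
qed

text \<open>Testing against \<open>V u\<close> in place of \<open>u\<close> gives the adjoint relation without mentioning adjoints.\<close>

lemma cinner_isometry_minus_scalar:
  assumes "isometry_op V"
  shows "cinner (V x - \<mu> *\<^sub>C x) (V u) = cinner x (u - cnj \<mu> *\<^sub>C V u)"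
  by (simp add: cinner_simps isometry_op_simps[OF assms])

text \<open>\<open>image\<close> makes \<open>V\<close> unitary on \<open>S\<close>. The locale is
  used for \<open>range P\<close> and again for the whole space.\<close>

locale reduced_isometry =
  fixes S :: "'a::chilbert_space set" and V :: "'a \<Rightarrow> 'a"
  assumes isometry: "isometry_op V"
    and subspace: "closed_subspace S"
    and image: "V ` S = S"
begin

lemmas V_simps = isometry_op_simps[OF isometry]

lemma V_in: "x \<in> S \<Longrightarrow> V x \<in> S"
  using image by blast

lemma V_minus_in: "x \<in> S \<Longrightarrow> V x - \<mu> *\<^sub>C x \<in> S"
  using closed_subspace_diff[OF subspace] closed_subspace_scaleC[OF subspace] V_in by blast

text \<open>The lower bound gives injectivity and a closed range. A vector of \<open>S\<close>
  orthogonal to the range is some \<open>V u\<close>, and the substitute for normality puts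
  \<open>u\<close> in the kernel.\<close>

lemma bij_if_bounded_below:
  assumes c: "c > 0" and lb: "\<And>x. x \<in> S \<Longrightarrow> c * norm x \<le> norm (V x - \<mu> *\<^sub>C x)"
  shows "bij_betw (\<lambda>x. V x - \<mu> *\<^sub>C x) S S"
proof -
  define N where "N x = V x - \<mu> *\<^sub>C x" for x
  have N_diff: "N (x - y) = N x - N y" and N_add: "N (x + y) = N x + N y"
    and N_scale: "N (a *\<^sub>C x) = a *\<^sub>C N x" for x y a
    by (simp_all add: N_def V_simps scaleC_simps mult.commute)
  have lbN: "c * norm x \<le> norm (N x)" if "x \<in> S" for x using lb that by (simp add: N_def)
  have inj: "inj_on N S"
  proof (rule inj_onI)
    fix x y assume "x \<in> S" "y \<in> S" "N x = N y"
    then have "c * norm (x - y) \<le> 0"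
      using lbN[of "x - y"] closed_subspace_diff[OF subspace] by (simp add: N_diff)
    then show "x = y" using c by (simp add: mult_le_0_iff)
  qed
  have NS: "N ` S \<subseteq> S" using V_minus_in by (auto simp: N_def)
  have bl: "bounded_linear N"
    unfolding N_def by (intro bounded_linear_sub isometry_op_bounded_linear isometry bounded_linear_scaleC_right)
  have "closed (N ` S)"
    unfolding closed_sequential_limits
  proof (intro allI impI, elim conjE)
    fix y l assume y: "\<forall>n. y n \<in> N ` S" and l: "y \<longlonglongrightarrow> l"
    from y have "\<forall>n. \<exists>x. x \<in> S \<and> y n = N x" by blast
    then obtain x where x: "\<And>n. x n \<in> S" "\<And>n. y n = N (x n)" by metis
    have "Cauchy x"
    proof (rule metric_CauchyI)
      fix e :: real assume "e > 0"
      then obtain M where M: "\<forall>m\<ge>M. \<forall>n\<ge>M. dist (y m) (y n) < c * e"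
        using metric_CauchyD[OF LIMSEQ_imp_Cauchy[OF l], of "c * e"] c by auto
      have "dist (x m) (x n) < e" if "m \<ge> M" "n \<ge> M" for m n
      proof -
        have "c * dist (x m) (x n) \<le> dist (y m) (y n)"
          using lbN[of "x m - x n"] x closed_subspace_diff[OF subspace] by (simp add: dist_norm N_diff)
        also have "\<dots> < c * e" using M that by blast
        finally show ?thesis using c by simp
      qed
      then show "\<exists>M. \<forall>m\<ge>M. \<forall>n\<ge>M. dist (x m) (x n) < e" by blast
    qed
    then obtain z where z: "x \<longlonglongrightarrow> z" using Cauchy_convergent convergent_def by metis
    have "z \<in> S"
      using subspace closed_sequentially[OF _ _ z] x(1) by (auto simp: closed_subspace_def)
    moreover have "(\<lambda>n. N (x n)) \<longlonglongrightarrow> N z" by (rule bounded_linear.tendsto[OF bl z])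
    then have "N z = l" using l LIMSEQ_unique by (simp add: x(2)[symmetric])
    ultimately show "l \<in> N ` S" by blast
  qed
  moreover have "0 \<in> N ` S"
    using closed_subspace_zero[OF subspace] by (auto simp: N_def V_simps intro: image_eqI[of _ _ 0])
  ultimately have R: "closed_subspace (N ` S)"
    unfolding closed_subspace_def
    using closed_subspace_add[OF subspace] closed_subspace_scaleC[OF subspace]
    by (auto simp: N_add[symmetric] N_scale[symmetric])
  have "S \<subseteq> N ` S"
  proof
    fix v assume v: "v \<in> S"
    obtain m where m: "m \<in> N ` S" "\<forall>x\<in>N ` S. cinner x (v - m) = 0"
      using closed_subspace_projection[OF R] by blast
    have "v - m \<in> S" using v m(1) NS closed_subspace_diff[OF subspace] by blast
    then obtain u where u: "u \<in> S" "v - m = V u" using image by blast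
    \<comment> \<open>For this vector the pairing of \<open>N ?w\<close> with \<open>V u\<close>
      equals the squared norm of \<open>?w\<close>.\<close>
    have "u - cnj \<mu> *\<^sub>C V u \<in> S" (is "?w \<in> S")
      using u closed_subspace_diff[OF subspace] closed_subspace_scaleC[OF subspace] V_in by metis
    then have "cinner (N ?w) (V u) = 0" using m(2) u(2) by simp
    then have "?w = 0"
      by (simp add: N_def cinner_isometry_minus_scalar[OF isometry] cinner_eq_zero_iff)
    then have "N u = 0"
      using norm_isometry_minus_scalar[OF isometry, of u \<mu>] by (simp add: N_def)
    then have "u = 0" using lbN[OF u(1)] c by (simp add: mult_le_0_iff)
    then show "v \<in> N ` S" using u(2) m(1) by (simp add: V_simps)
  qed
  then have "bij_betw N S S" using inj NS by (auto simp: bij_betw_def)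
  then show ?thesis by (simp add: N_def[abs_def])
qed

text \<open>The inverse is bounded because \<open>Y\<close> is weakly bounded: a preimage
  \<open>x\<close> of the \<open>S\<close>-component of \<open>v\<close> gives
  \<open>|cinner (V u) v| \<le> norm x\<close> whenever \<open>V u - \<mu> *\<^sub>C u\<close> has
  norm at most 1.\<close>

lemma bounded_below_if_bij:
  assumes bij: "bij_betw (\<lambda>x. V x - \<mu> *\<^sub>C x) S S"
  obtains c where "c > 0" "\<And>x. x \<in> S \<Longrightarrow> c * norm x \<le> norm (V x - \<mu> *\<^sub>C x)"
proof -
  define Y where "Y = {V u | u. u \<in> S \<and> norm (V u - \<mu> *\<^sub>C u) \<le> 1}"
  have "\<exists>K. \<forall>y\<in>Y. cmod (cinner y v) \<le> K" for v
  proof -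
    obtain m where m: "m \<in> S" "\<forall>x\<in>S. cinner x (v - m) = 0"
      using closed_subspace_projection[OF subspace] by blast
    obtain x where x: "x \<in> S" "m = V x - \<mu> *\<^sub>C x"
      using bij m(1) by (auto simp: bij_betw_def)
    have "cmod (cinner (V u) v) \<le> norm x" if u: "u \<in> S" "norm (V u - \<mu> *\<^sub>C u) \<le> 1" for u
    proof -
      have "cinner (V u) v = cinner (V u) m"
        using m(2) V_in[OF u(1)] by (simp add: cinner_diff_right)
      then have "cmod (cinner (V u) v) = cmod (cinner m (V u))"
        by (subst (asm) cinner_commute) simp
      also have "\<dots> = cmod (cinner x (u - cnj \<mu> *\<^sub>C V u))"
        by (simp add: x(2) cinner_isometry_minus_scalar[OF isometry])
      also have "\<dots> \<le> norm x * norm (V u - \<mu> *\<^sub>C u)"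
        using norm_cinner_le norm_isometry_minus_scalar[OF isometry] by metis
      also have "\<dots> \<le> norm x" using u(2) by (simp add: mult_left_le)
      finally show ?thesis .
    qed
    then show ?thesis unfolding Y_def by blast
  qed
  then obtain K where K: "\<And>y. y \<in> Y \<Longrightarrow> norm y \<le> K"
    using uniform_boundedness[of Y] by metis
  define c where "c = 1 / max K 1"
  have c: "c > 0" by (simp add: c_def)
  have "c * norm u \<le> norm (V u - \<mu> *\<^sub>C u)" if u: "u \<in> S" for u
  proof (cases "V u - \<mu> *\<^sub>C u = 0")
    case True
    then have "u = 0"
      using bij u closed_subspace_zero[OF subspace]
      by (auto simp: bij_betw_def V_simps dest: inj_onD[of _ _ u 0])
    then show ?thesis by simp
  next
    case False
    define d where "d = norm (V u - \<mu> *\<^sub>C u)"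
    have d: "d > 0" using False by (simp add: d_def)
    define w where "w = complex_of_real (1 / d) *\<^sub>C u"
    have "V w - \<mu> *\<^sub>C w = complex_of_real (1 / d) *\<^sub>C (V u - \<mu> *\<^sub>C u)"
      by (simp add: w_def V_simps scaleC_simps mult.commute)
    then have "norm (V w - \<mu> *\<^sub>C w) = 1"
      using d by (simp add: norm_scaleC norm_divide d_def)
    moreover have "w \<in> S" unfolding w_def by (rule closed_subspace_scaleC[OF subspace u])
    ultimately have "V w \<in> Y" by (auto simp: Y_def)
    then have "norm u / d \<le> K" using K d by (fastforce simp: V_simps w_def norm_scaleC norm_divide)
    then have "norm u / d \<le> max K 1" by simp
    then show ?thesis using d by (simp add: c_def divide_simps d_def[symmetric] mult.commute)
  qed
  with c show ?thesis by (rule that)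
qed

text \<open>On \<open>S\<close> invertibility of \<open>V - \<mu>\<close> equals boundedness below,
  so the whole spectrum is approximate point spectrum. The unit vectors obtained here are the raw
  material of the test vectors.\<close>

lemma op_spectrum_iff_approximate_eigenvalue:
  "\<mu> \<in> op_spectrum S V \<longleftrightarrow> (\<forall>e>0. \<exists>x\<in>S. norm x = 1 \<and> norm (V x - \<mu> *\<^sub>C x) < e)"
proof
  assume sp: "\<mu> \<in> op_spectrum S V"
  show "\<forall>e>0. \<exists>x\<in>S. norm x = 1 \<and> norm (V x - \<mu> *\<^sub>C x) < e"
  proof (rule ccontr)
    assume "\<not> ?thesis"
    then obtain e where e: "e > 0" "\<And>x. x \<in> S \<Longrightarrow> norm x = 1 \<Longrightarrow> e \<le> norm (V x - \<mu> *\<^sub>C x)"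
      by (auto simp: not_less)
    have "e * norm x \<le> norm (V x - \<mu> *\<^sub>C x)" if x: "x \<in> S" for x
    proof (cases "x = 0")
      case False
      define w where "w = complex_of_real (1 / norm x) *\<^sub>C x"
      have "w \<in> S" unfolding w_def by (rule closed_subspace_scaleC[OF subspace x])
      moreover have "norm w = 1" using False by (simp add: w_def norm_scaleC norm_divide)
      ultimately have "e \<le> norm (V w - \<mu> *\<^sub>C w)" by (rule e(2))
      moreover have "V w - \<mu> *\<^sub>C w = complex_of_real (1 / norm x) *\<^sub>C (V x - \<mu> *\<^sub>C x)"
        by (simp add: w_def V_simps scaleC_simps mult.commute)
      ultimately have "e \<le> norm (V x - \<mu> *\<^sub>C x) / norm x"
        by (simp add: norm_scaleC norm_divide)
      then show ?thesis using False by (simp add: pos_le_divide_eq)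
    qed simp
    then show False
      using bij_if_bounded_below[OF e(1)] sp by (auto simp: op_spectrum_def)
  qed
next
  assume ap: "\<forall>e>0. \<exists>x\<in>S. norm x = 1 \<and> norm (V x - \<mu> *\<^sub>C x) < e"
  show "\<mu> \<in> op_spectrum S V"
  proof (rule ccontr)
    assume "\<mu> \<notin> op_spectrum S V"
    then obtain c where c: "c > 0" "\<And>x. x \<in> S \<Longrightarrow> c * norm x \<le> norm (V x - \<mu> *\<^sub>C x)"
      using bounded_below_if_bij[of \<mu>] unfolding op_spectrum_def by blast
    from ap c(1) obtain x where "x \<in> S" "norm x = 1" "norm (V x - \<mu> *\<^sub>C x) < c" by blast
    with c(2)[of x] show False by simp
  qed
qed

lemma op_spectrum_norm:
  assumes "\<mu> \<in> op_spectrum S V"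
  shows "cmod \<mu> = 1"
proof (rule ccontr)
  assume "cmod \<mu> \<noteq> 1"
  then have "\<bar>1 - cmod \<mu>\<bar> > 0" by simp
  then obtain x where x: "norm x = 1" "norm (V x - \<mu> *\<^sub>C x) < \<bar>1 - cmod \<mu>\<bar>"
    using assms op_spectrum_iff_approximate_eigenvalue by blast
  have "\<bar>norm (V x) - norm (\<mu> *\<^sub>C x)\<bar> \<le> norm (V x - \<mu> *\<^sub>C x)"
    by (rule norm_triangle_ineq3)
  with x show False by (simp add: norm_scaleC V_simps)
qed

lemma closed_op_spectrum: "closed (op_spectrum S V)"
  unfolding closed_sequential_limits
proof (intro allI impI, elim conjE)
  fix \<mu> l assume \<mu>: "\<forall>n::nat. \<mu> n \<in> op_spectrum S V" and l: "\<mu> \<longlonglongrightarrow> l"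
  show "l \<in> op_spectrum S V"
    unfolding op_spectrum_iff_approximate_eigenvalue
  proof (intro allI impI)
    fix e :: real assume "e > 0"
    then obtain n where n: "dist (\<mu> n) l < e / 2"
      using metric_LIMSEQ_D[OF l, of "e/2"] by auto
    obtain x where x: "x \<in> S" "norm x = 1" "norm (V x - \<mu> n *\<^sub>C x) < e / 2"
      using \<mu> \<open>e > 0\<close> op_spectrum_iff_approximate_eigenvalue half_gt_zero by blast
    have "V x - l *\<^sub>C x = (V x - \<mu> n *\<^sub>C x) + (\<mu> n - l) *\<^sub>C x"
      by (simp add: scaleC_simps)
    then have "norm (V x - l *\<^sub>C x) \<le> norm (V x - \<mu> n *\<^sub>C x) + norm ((\<mu> n - l) *\<^sub>C x)"
      by (metis norm_triangle_ineq)
    also have "\<dots> < e" using x n by (simp add: norm_scaleC dist_norm)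
    finally show "\<exists>x\<in>S. norm x = 1 \<and> norm (V x - l *\<^sub>C x) < e" using x by blast
  qed
qed

end

text \<open>With \<open>\<kappa>\<^sup>2 = \<nu>\<close>, the vector \<open>V\<^sup>2 y - \<nu> y\<close> is \<open>(V \<mp> \<kappa>) (V y \<plusminus> \<kappa> y)\<close>, and by the parallelogram law
  one of \<open>V y \<plusminus> \<kappa> y\<close> has norm at least \<open>sqrt 2 * norm y\<close>. So passing from \<open>V\<^sup>2\<close> to \<open>V\<close> improves an
  approximate eigenvector by a factor \<open>sqrt 2\<close>, and we start from a high power of \<open>V\<close>.\<close>

lemma isometry_approximate_eigenvector:
  assumes "isometry_op V" "closed_subspace S" "V ` S \<subseteq> S" "y0 \<in> S" "y0 \<noteq> 0"
  shows "\<exists>\<nu> y. cmod \<nu> = 1 \<and> y \<in> S \<and> y \<noteq> 0 \<and> norm (V y - \<nu> *\<^sub>C y) \<le> 2 / sqrt 2 ^ m * norm y"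
  using assms(1,3)
proof (induction m arbitrary: V)
  case 0
  have "norm (V y0 - 1 *\<^sub>C y0) \<le> 2 * norm y0"
    using norm_triangle_ineq4[of "V y0" "1 *\<^sub>C y0"] by (simp add: isometry_op_simps[OF 0(1)] scaleC_one)
  then show ?case using assms(4,5) by (intro exI[of _ 1] exI[of _ y0]) simp
next
  case (Suc m)
  note V = isometry_op_simps[OF Suc.prems(1)]
  obtain \<nu> y where y: "cmod \<nu> = 1" "y \<in> S" "y \<noteq> 0"
      "norm (V (V y) - \<nu> *\<^sub>C y) \<le> 2 / sqrt 2 ^ m * norm y"
    using Suc.IH[OF isometry_op_compose[OF Suc.prems(1) Suc.prems(1)]] Suc.prems(2) by blast
  have "cmod (csqrt \<nu>) = 1" using y(1) by simp
  moreover have "\<exists>s\<in>{1, -1}. 2 * (norm y)\<^sup>2 \<le> (norm (V y + (s * csqrt \<nu>) *\<^sub>C y))\<^sup>2"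
    using parallelogram[of "V y" "csqrt \<nu> *\<^sub>C y"] calculation
    by (auto simp: V norm_scaleC scaleC_simps)
  then obtain s where s: "s \<in> {1, -1}" "2 * (norm y)\<^sup>2 \<le> (norm (V y + (s * csqrt \<nu>) *\<^sub>C y))\<^sup>2" by blast
  define \<kappa> where "\<kappa> = s * csqrt \<nu>"
  define w where "w = V y + \<kappa> *\<^sub>C y"
  have \<kappa>: "cmod \<kappa> = 1" "\<kappa> * \<kappa> = \<nu>"
    using s(1) y(1) by (auto simp: \<kappa>_def norm_mult power2_eq_square[symmetric])
  have "(sqrt 2 * norm y)\<^sup>2 \<le> (norm w)\<^sup>2"
    using s(2) by (simp add: power_mult_distrib w_def \<kappa>_def)
  then have w: "sqrt 2 * norm y \<le> norm w" by (rule power2_le_imp_le) simp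
  then have "w \<noteq> 0" using y(3) by (auto simp: mult_le_0_iff)
  moreover have "w \<in> S"
    unfolding w_def using y(2) Suc.prems(2) assms(2) closed_subspace_add closed_subspace_scaleC by blast
  moreover have "V w - \<kappa> *\<^sub>C w = V (V y) - \<nu> *\<^sub>C y"
    by (simp add: w_def V scaleC_simps \<kappa>(2))
  then have "norm (V w - \<kappa> *\<^sub>C w) \<le> 2 / sqrt 2 ^ Suc m * (sqrt 2 * norm y)"
    using y(4) by simp
  then have "norm (V w - \<kappa> *\<^sub>C w) \<le> 2 / sqrt 2 ^ Suc m * norm w"
    using mult_left_mono[OF w, of "2 / sqrt 2 ^ Suc m"] by simp
  ultimately show ?case using \<kappa>(1) by blast
qed

text \<open>The approximate eigenvalues lie on the unit circle. A limit point of them is in the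
  spectrum, because the errors \<open>2 / sqrt 2 ^ m\<close> tend to 0.\<close>

lemma (in reduced_isometry) op_spectrum_nonempty:
  assumes "S \<noteq> {0}"
  shows "op_spectrum S V \<noteq> {}"
proof -
  obtain y0 where "y0 \<in> S" "y0 \<noteq> 0" using assms closed_subspace_zero[OF subspace] by blast
  then have "\<forall>m. \<exists>\<nu> y. cmod \<nu> = 1 \<and> y \<in> S \<and> y \<noteq> 0 \<and> norm (V y - \<nu> *\<^sub>C y) \<le> 2 / sqrt 2 ^ m * norm y"
    using isometry_approximate_eigenvector[OF isometry subspace] image by blast
  then obtain \<nu> y where y: "\<And>m. cmod (\<nu> m) = 1" "\<And>m. y m \<in> S" "\<And>m. y m \<noteq> 0"
      "\<And>m. norm (V (y m) - \<nu> m *\<^sub>C y m) \<le> 2 / sqrt 2 ^ m * norm (y m)"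
    by metis
  have "\<forall>m. \<nu> m \<in> sphere 0 1" using y(1) by simp
  then obtain l r where lr: "strict_mono (r :: nat \<Rightarrow> nat)" "(\<nu> \<circ> r) \<longlonglongrightarrow> l"
    using compact_sphere unfolding compact_def by metis
  have "l \<in> op_spectrum S V"
    unfolding op_spectrum_iff_approximate_eigenvalue
  proof (intro allI impI)
    fix e :: real assume "e > 0"
    have "(\<lambda>m. 2 * (1 / sqrt 2) ^ m) \<longlonglongrightarrow> 2 * 0"
      by (intro tendsto_intros LIMSEQ_power_zero) simp
    then have "(\<lambda>m. 2 / sqrt 2 ^ m) \<longlonglongrightarrow> 0" by (simp add: power_divide)
    then have "((\<lambda>m. 2 / sqrt 2 ^ m) \<circ> r) \<longlonglongrightarrow> 0" using lr(1) by (rule LIMSEQ_subseq_LIMSEQ)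
    then have "\<forall>\<^sub>F m in sequentially. ((\<lambda>m. 2 / sqrt 2 ^ m) \<circ> r) m < e / 2"
      using \<open>e > 0\<close> by (elim order_tendstoD(2)) simp
    moreover have "\<forall>\<^sub>F m in sequentially. dist ((\<nu> \<circ> r) m) l < e / 2"
      using tendstoD[OF lr(2), of "e/2"] \<open>e > 0\<close> by simp
    ultimately have "\<exists>m. 2 / sqrt 2 ^ r m < e / 2 \<and> dist (\<nu> (r m)) l < e / 2"
      using eventually_happens[OF eventually_conj] by fastforce
    then obtain k where k: "2 / sqrt 2 ^ k < e / 2" "dist (\<nu> k) l < e / 2" by blast
    define x where "x = complex_of_real (1 / norm (y k)) *\<^sub>C y k"
    have x: "x \<in> S" "norm x = 1"
      using y(2,3)[of k] closed_subspace_scaleC[OF subspace]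
      by (auto simp: x_def norm_scaleC norm_divide)
    have "V x - \<nu> k *\<^sub>C x = complex_of_real (1 / norm (y k)) *\<^sub>C (V (y k) - \<nu> k *\<^sub>C y k)"
      by (simp add: x_def V_simps scaleC_simps mult.commute)
    then have "norm (V x - \<nu> k *\<^sub>C x) \<le> 2 / sqrt 2 ^ k"
      using y(3,4)[of k] by (simp add: norm_scaleC norm_divide pos_divide_le_eq)
    moreover have "V x - l *\<^sub>C x = (V x - \<nu> k *\<^sub>C x) + (\<nu> k - l) *\<^sub>C x"
      by (simp add: scaleC_simps)
    then have "norm (V x - l *\<^sub>C x) \<le> norm (V x - \<nu> k *\<^sub>C x) + norm ((\<nu> k - l) *\<^sub>C x)"
      by (metis norm_triangle_ineq)
    ultimately have "norm (V x - l *\<^sub>C x) < e"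
      using k x(2) by (simp add: norm_scaleC dist_norm)
    then show "\<exists>x\<in>S. norm x = 1 \<and> norm (V x - l *\<^sub>C x) < e" using x by blast
  qed
  then show ?thesis by blast
qed

section \<open>Koszul complexes\<close>

text \<open>The coefficients form a contracting homotopy: at the middle stage
  \<open>B1 h1 + B2 h2\<close> is the preimage, since \<open>A1 h2 = A2 h1\<close> lets the two
  operators be traded under \<open>B1\<close> and \<open>B2\<close>.\<close>

lemma koszul_exactI:
  assumes S: "\<And>x y. x \<in> S \<Longrightarrow> y \<in> S \<Longrightarrow> x + y \<in> S"
    and A_in: "\<And>x. x \<in> S \<Longrightarrow> A1 x \<in> S" "\<And>x. x \<in> S \<Longrightarrow> A2 x \<in> S"
    and B_in: "\<And>x. x \<in> S \<Longrightarrow> B1 x \<in> S" "\<And>x. x \<in> S \<Longrightarrow> B2 x \<in> S"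
    and add: "\<And>x y. x \<in> S \<Longrightarrow> y \<in> S \<Longrightarrow> A1 (x + y) = A1 x + A1 y"
      "\<And>x y. x \<in> S \<Longrightarrow> y \<in> S \<Longrightarrow> A2 (x + y) = A2 x + A2 y"
    and zero: "B1 0 = 0" "B2 0 = 0"
    and comm: "\<And>x. x \<in> S \<Longrightarrow> A1 (B1 x) = B1 (A1 x)" "\<And>x. x \<in> S \<Longrightarrow> A1 (B2 x) = B2 (A1 x)"
      "\<And>x. x \<in> S \<Longrightarrow> A2 (B1 x) = B1 (A2 x)" "\<And>x. x \<in> S \<Longrightarrow> A2 (B2 x) = B2 (A2 x)"
    and id: "\<And>x. x \<in> S \<Longrightarrow> B1 (A1 x) + B2 (A2 x) = x"
  shows "koszul_exact S A1 A2"
  unfolding koszul_exact_def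
proof (intro conjI)
  show "koszul_exact_1 S A1 A2"
    unfolding koszul_exact_1_def using id zero by fastforce
  show "koszul_exact_2 S A1 A2"
    unfolding koszul_exact_2_def
  proof (intro ballI impI)
    fix h1 h2 assume h: "h1 \<in> S" "h2 \<in> S" "A1 h2 - A2 h1 = 0"
    then have eq: "A1 h2 = A2 h1" by simp
    show "\<exists>h\<in>S. h1 = A1 h \<and> h2 = A2 h"
    proof (intro bexI conjI)
      show "B1 h1 + B2 h2 \<in> S" using h S B_in by blast
      show "h1 = A1 (B1 h1 + B2 h2)"
        using id[OF h(1)] by (simp add: add B_in h comm eq)
      show "h2 = A2 (B1 h1 + B2 h2)"
        using id[OF h(2)] by (simp add: add B_in h comm eq)
    qed
  qed
  show "koszul_exact_3 S A1 A2"
    unfolding koszul_exact_3_def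
  proof (intro equalityI subsetI)
    fix x assume x: "x \<in> S"
    then have "x = A1 (B1 x) + A2 (B2 x)" using id comm by simp
    then show "x \<in> {A1 a + A2 b |a b. a \<in> S \<and> b \<in> S}" using x B_in by blast
  qed (use S A_in in auto)
qed

section \<open>The functions of a BCL triple whose unitary swaps the two ranges\<close>

lemma projection_op_simps:
  assumes "projection_op P"
  shows "P (x + y) = P x + P y" "P (c *\<^sub>C x) = c *\<^sub>C P x" "P (x - y) = P x - P y"
    "P (P x) = P x" "cinner (P x) y = cinner x (P y)"
    "cinner (P x) (y - P y) = 0" "bounded_linear P"
proof -
  have P: "bounded_op P" "clinear_op P" "P \<circ> P = P" "adj P = P"
    using assms by (auto simp: projection_op_def bounded_op_def)
  show "bounded_linear P" by (rule bounded_op_bounded_linear[OF P(1)])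
  then interpret bounded_linear P .
  show "P (x + y) = P x + P y" "P (c *\<^sub>C x) = c *\<^sub>C P x" and diff: "P (x - y) = P x - P y" for x y
    using P(2) diff by (auto simp: clinear_op_def)
  show idem: "P (P x) = P x" for x using P(3) by (metis comp_apply)
  show sa: "cinner (P x) y = cinner x (P y)" for y using cinner_adj[OF P(1)] P(4) by simp
  show "cinner (P x) (y - P y) = 0" by (simp add: sa diff idem)
qed

lemma projection_op_norm:
  assumes "projection_op P"
  shows "(norm x)\<^sup>2 = (norm (P x))\<^sup>2 + (norm (x - P x))\<^sup>2"
  using norm_add_square[of "P x" "x - P x"] by (simp add: projection_op_simps[OF assms])

lemma projection_op_closed_subspace:
  assumes "projection_op P"
  shows "closed_subspace (range P)"
proof -
  note P = projection_op_simps[OF assms]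
  have "range P = {x. P x = x}" using P(4) by (auto intro: rangeI) (metis rangeI)
  moreover have "closed {x. P x = x}"
    by (intro closed_Collect_eq bounded_linear.continuous_on[OF P(7)] continuous_intros)
  moreover have "P 0 = 0" using P(2)[of 0 0] by simp
  ultimately show ?thesis by (simp add: closed_subspace_def P)
qed

lemma unitary_op_adj:
  assumes "unitary_op U"
  shows "adj U (U x) = x" "U (adj U y) = y" "isometry_op (adj U)"
proof -
  have U: "isometry_op U" "surj U" using assms by (auto simp: unitary_op_def)
  note U' = isometry_op_simps[OF U(1)]
  show left: "adj U (U x) = x" for x
    by (rule adj_eqI) (simp add: U')
  show right: "U (adj U y) = y" for y
    using left U(2) by (metis surjD)
  have "clinear_op (adj U)"
    unfolding clinear_op_def by (metis U'(1,2) left right)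
  moreover have norm: "norm (adj U y) = norm y" for y
    by (metis U'(5) right)
  then have "\<exists>K. \<forall>y. norm (adj U y) \<le> K * norm y"
    by (intro exI[of _ 1]) simp
  ultimately show "isometry_op (adj U)"
    using norm by (simp add: isometry_op_def bounded_op_def)
qed

text \<open>As \<open>U\<close> is onto, \<open>swap\<close> says that \<open>U\<close> conjugates
  \<open>I - P\<close> into \<open>P\<close>; it thus contains both equalities
  \<open>U (ran P^perp) = ran P\<close> and \<open>U (ran P) = ran P^perp\<close>.\<close>

locale bcl_swap =
  fixes P U :: "'e::chilbert_space \<Rightarrow> 'e"
  assumes proj: "projection_op P"
    and unitary: "unitary_op U"
    and swap: "\<And>x. P (U x) = U (x - P x)"
begin

abbreviation "T1 \<equiv> bcl_phi1 P U"
abbreviation "T2 \<equiv> bcl_phi2 P U"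
abbreviation "W \<equiv> \<lambda>x. U (U x)"
abbreviation "\<sigma>W \<equiv> op_spectrum (range P) W"

lemma isometry_U: "isometry_op U"
  using unitary by (simp add: unitary_op_def)

lemmas P_simps = projection_op_simps[OF proj]
lemmas U_simps = isometry_op_simps[OF isometry_U]
lemmas adj_simps = isometry_op_simps[OF unitary_op_adj(3)[OF unitary]] unitary_op_adj(1,2)[OF unitary]

lemma T2_eq: "T2 z x = U (x - P x + z *\<^sub>C P x)"
  by (simp add: bcl_phi2_def swap U_simps algebra_simps)

lemma W_T1: "W (T1 z x) = T2 z x"
  by (simp only: T2_eq bcl_phi1_def adj_simps(8))

lemma T1_linear: "T1 z (x + y) = T1 z x + T1 z y" "T1 z (c *\<^sub>C x) = c *\<^sub>C T1 z x"
  "T1 z (x - y) = T1 z x - T1 z y" "T1 z 0 = 0" "T1 z (- x) = - T1 z x"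
proof -
  show add: "T1 z (x + y) = T1 z x + T1 z y" and scale: "T1 z (c *\<^sub>C x) = c *\<^sub>C T1 z x" for x y c
    by (simp_all add: bcl_phi1_def P_simps adj_simps scaleC_simps mult.commute algebra_simps)
  show "T1 z (x - y) = T1 z x - T1 z y" using add[of "x - y" y] by simp
  show "T1 z 0 = 0" using scale[of 0 0] by simp
  show "T1 z (- x) = - T1 z x" using scale[of "- 1" x] by (simp add: scaleC_simps)
qed

lemma P_W: "P (W x) = W (P x)"
  by (simp add: swap U_simps)

text \<open>Moving \<open>U\<close> to the left exchanges \<open>P\<close> and its complement, so
  the middle factors become \<open>(I - P) + z P\<close> and \<open>P + z (I - P)\<close>, whose
  product is \<open>z\<close>.\<close>

lemma T1_T2: "T1 z (T2 z x) = z *\<^sub>C x"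
proof -
  define y where "y = x - P x + z *\<^sub>C P x"
  have "U y - P (U y) + z *\<^sub>C P (U y) = U (P y + z *\<^sub>C (y - P y))"
    by (simp add: swap U_simps)
  moreover have "P y = z *\<^sub>C P x" by (simp add: y_def P_simps)
  moreover have "y - P y = x - P x" using calculation(2) by (simp add: y_def)
  then have "P y + z *\<^sub>C (y - P y) = z *\<^sub>C x"
    unfolding calculation(2) by (simp add: y_def scaleC_simps)
  ultimately have "U y - P (U y) + z *\<^sub>C P (U y) = U (z *\<^sub>C x)"
    by (simp only:)
  then show ?thesis
    by (simp only: bcl_phi1_def T2_eq y_def[symmetric] adj_simps(7))
qed

lemma T1_W: "T1 z (W x) = W (T1 z x)"
  by (simp add: bcl_phi1_def adj_simps U_simps swap)

lemma T2_T1: "T2 z (T1 z x) = z *\<^sub>C x"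
  using T1_T2[of z x] by (simp add: W_T1[symmetric] T1_W)

lemma norm_T1_le:
  assumes "cmod z \<le> 1"
  shows "norm (T1 z x) \<le> norm x"
proof -
  have "(norm (T1 z x))\<^sup>2 = (norm ((x - P x) + z *\<^sub>C P x))\<^sup>2"
    by (simp only: bcl_phi1_def adj_simps(5))
  also have "\<dots> = (norm (x - P x))\<^sup>2 + (cmod z)\<^sup>2 * (norm (P x))\<^sup>2"
  proof -
    have "cinner (x - P x) (z *\<^sub>C P x) = z * cnj (cinner (P x) (x - P x))"
      by (subst cinner_commute) (simp add: cinner_simps)
    then show ?thesis by (simp add: norm_add_square norm_scaleC power_mult_distrib P_simps)
  qed
  also have "\<dots> \<le> (norm (x - P x))\<^sup>2 + 1 * (norm (P x))\<^sup>2"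
    using assms by (intro add_left_mono mult_right_mono) (auto simp: power_le_one)
  also have "\<dots> = (norm x)\<^sup>2" by (simp add: projection_op_norm[OF proj, of x])
  finally show ?thesis by (rule power2_le_imp_le) simp
qed

lemma surj_W: "surj W"
  by (rule surjI[of _ "\<lambda>x. adj U (adj U x)"]) (simp add: adj_simps)

sublocale W: reduced_isometry "range P" W
proof
  show "isometry_op W" by (rule isometry_op_compose[OF isometry_U isometry_U])
  show "closed_subspace (range P)" by (rule projection_op_closed_subspace[OF proj])
  show "W ` range P = range P"
  proof
    show "W ` range P \<subseteq> range P" by (auto simp: P_W[symmetric])
    have "P x \<in> W ` range P" for x
    proof -
      obtain y where "x = W y" using surj_W by (meson surjD)
      then show ?thesis using P_W by blast
    qed
    then show "range P \<subseteq> W ` range P" by blast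
  qed
qed

text \<open>The hypothesis concerns \<open>range P\<close>. The complement inherits the same
  constant, as \<open>U\<close> maps it isometrically into \<open>range P\<close> and commutes with
  \<open>W\<close>; the orthogonal parts add by Pythagoras.\<close>

lemma bij_W_minus_scalar:
  assumes "\<mu> \<notin> \<sigma>W"
  obtains c where "c > 0" "\<And>x. c * norm x \<le> norm (W x - \<mu> *\<^sub>C x)" "bij (\<lambda>x. W x - \<mu> *\<^sub>C x)"
proof -
  obtain c where c: "c > 0" "\<And>x. x \<in> range P \<Longrightarrow> c * norm x \<le> norm (W x - \<mu> *\<^sub>C x)"
    using W.bounded_below_if_bij assms by (auto simp: op_spectrum_def)
  have lb: "c * norm x \<le> norm (W x - \<mu> *\<^sub>C x)" for x
  proof -
    let ?N = "\<lambda>x. W x - \<mu> *\<^sub>C x"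
    have N1: "P (?N x) = ?N (P x)" by (simp add: P_simps P_W)
    then have N2: "?N x - P (?N x) = ?N (x - P x)"
      by (simp add: U_simps scaleC_simps)
    have p1: "c * norm (P x) \<le> norm (?N (P x))" using c(2) by blast
    have "U (x - P x) \<in> range P" by (metis swap rangeI)
    then have "c * norm (U (x - P x)) \<le> norm (?N (U (x - P x)))" by (rule c(2))
    also have "?N (U (x - P x)) = U (?N (x - P x))" by (simp add: U_simps)
    finally have p2: "c * norm (x - P x) \<le> norm (?N (x - P x))" by (simp add: U_simps(5))
    have "(c * norm x)\<^sup>2 = (c * norm (P x))\<^sup>2 + (c * norm (x - P x))\<^sup>2"
      using projection_op_norm[OF proj, of x] by (simp add: power_mult_distrib distrib_left[symmetric])
    also have "\<dots> \<le> (norm (?N (P x)))\<^sup>2 + (norm (?N (x - P x)))\<^sup>2"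
      using p1 p2 c(1) by (intro add_mono power_mono) auto
    also have "\<dots> = (norm (?N x))\<^sup>2"
      using projection_op_norm[OF proj, of "?N x"] N1 N2 by simp
    finally show ?thesis by (rule power2_le_imp_le) simp
  qed
  interpret all: reduced_isometry UNIV W
    using W.isometry surj_W by unfold_locales (auto simp: closed_subspace_def)
  show ?thesis using that[OF c(1) lb] all.bij_if_bounded_below[OF c(1), of \<mu>] lb by blast
qed

lemma resolvent:
  assumes "\<mu> \<notin> \<sigma>W"
  obtains R where "bounded_op R" "\<And>x. R (W x - \<mu> *\<^sub>C x) = x" "\<And>x. W (R x) - \<mu> *\<^sub>C R x = x"
proof -
  define N where "N x = W x - \<mu> *\<^sub>C x" for x
  obtain c where c: "c > 0" "\<And>x. c * norm x \<le> norm (N x)" "bij N"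
    using bij_W_minus_scalar[OF assms] unfolding N_def[abs_def] by blast
  define R where "R = inv N"
  have RN: "R (N x) = x" and NR: "N (R x) = x" for x
    using c(3) by (simp_all add: R_def bij_is_inj bij_is_surj surj_f_inv_f)
  have N_lin: "N (x + y) = N x + N y" "N (a *\<^sub>C x) = a *\<^sub>C N x" for x y a
    by (simp_all add: N_def U_simps scaleC_simps mult.commute)
  have "clinear_op R"
    unfolding clinear_op_def by (metis N_lin RN NR)
  moreover have "norm (R x) \<le> (1 / c) * norm x" for x
    using c(1) c(2)[of "R x"] by (simp add: NR field_simps)
  ultimately have "bounded_op R" unfolding bounded_op_def by blast
  then show ?thesis using that RN NR by (simp add: N_def)
qed

text \<open>A scalar in the ideal of the two Koszul operators, from
  \<open>T1 T2 = z\<close>.\<close>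

lemma combination_1:
  "l2 *\<^sub>C (T1 z x - l1 *\<^sub>C x) + T1 z (T2 z x - l2 *\<^sub>C x) = (z - l1 * l2) *\<^sub>C x"
  by (simp add: T1_linear T1_T2 scaleC_simps mult.commute algebra_simps)

text \<open>By \<open>W T1 = T2\<close> both functions cancel, leaving a pencil in \<open>W\<close>
  that is independent of \<open>z\<close>.\<close>

lemma combination_2:
  "(T2 z x - l2 *\<^sub>C x) - W (T1 z x - l1 *\<^sub>C x) = l1 *\<^sub>C W x - l2 *\<^sub>C x"
  by (simp add: U_simps W_T1)

text \<open>For \<open>l1 = 0\<close> the pencil is the scalar \<open>- l2\<close>; otherwise it is
  \<open>l1\<close> times \<open>W - l2 / l1\<close>. The pair (0, 0) is excluded, as the pencil
  vanishes there.\<close>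

lemma resolvent_pencil:
  assumes "l1 = 0 \<and> l2 \<noteq> 0 \<or> l1 \<noteq> 0 \<and> l2 / l1 \<notin> \<sigma>W"
  obtains R where "bounded_op R" "\<And>x. R (l1 *\<^sub>C W x - l2 *\<^sub>C x) = x"
    "\<And>x. l1 *\<^sub>C W (R x) - l2 *\<^sub>C R x = x"
  using assms
proof (elim disjE conjE)
  assume l: "l1 = 0" "l2 \<noteq> 0"
  define R :: "'e \<Rightarrow> 'e" where "R x = (- 1 / l2) *\<^sub>C x" for x
  have "clinear_op R"
    by (simp add: clinear_op_def R_def scaleC_simps mult.commute)
  moreover have "\<exists>K. \<forall>x. norm (R x) \<le> K * norm x"
    by (rule exI[of _ "cmod (- 1 / l2)"]) (simp add: R_def norm_scaleC)
  ultimately have "bounded_op R" by (simp add: bounded_op_def)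
  then show ?thesis using that[of R] l by (simp add: R_def scaleC_simps)
next
  assume l: "l1 \<noteq> 0" "l2 / l1 \<notin> \<sigma>W"
  obtain R where R: "bounded_op R" "\<And>x. R (W x - (l2 / l1) *\<^sub>C x) = x"
      "\<And>x. W (R x) - (l2 / l1) *\<^sub>C R x = x"
    using resolvent[OF l(2)] by blast
  interpret R: bounded_linear R by (rule bounded_op_bounded_linear[OF R(1)])
  have R_scale: "R (c *\<^sub>C x) = c *\<^sub>C R x" for c x
    using R(1) by (simp add: bounded_op_def clinear_op_def)
  define Q where "Q x = (1 / l1) *\<^sub>C R x" for x
  have "clinear_op Q"
    by (simp add: clinear_op_def Q_def scaleC_simps R.add R_scale mult.commute)
  moreover obtain K where K: "\<And>x. norm (R x) \<le> K * norm x"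
    using R(1) by (auto simp: bounded_op_def)
  have "norm (Q x) \<le> (cmod (1 / l1) * K) * norm x" for x
    using mult_left_mono[OF K, of "cmod (1 / l1)"] by (simp add: Q_def norm_scaleC mult.assoc)
  ultimately have "bounded_op Q" unfolding bounded_op_def by blast
  moreover have pencil: "l1 *\<^sub>C W x - l2 *\<^sub>C x = l1 *\<^sub>C (W x - (l2 / l1) *\<^sub>C x)" for x
    using l(1) by (simp add: scaleC_simps)
  then have "Q (l1 *\<^sub>C W x - l2 *\<^sub>C x) = x" for x
    using l(1) by (simp only: pencil Q_def R_scale R(2) scaleC_scaleC) (simp add: scaleC_one)
  moreover have "l1 *\<^sub>C W (Q x) - l2 *\<^sub>C Q x = x" for x
    unfolding pencil using l(1) R(3)[of x]
    by (simp add: Q_def U_simps scaleC_simps mult.commute)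
  ultimately show ?thesis by (rule that)
qed

lemma resolvent_pencil_commute:
  assumes R: "\<And>x. R (l1 *\<^sub>C W x - l2 *\<^sub>C x) = x" "\<And>x. l1 *\<^sub>C W (R x) - l2 *\<^sub>C R x = x"
    and A: "\<And>x. A (l1 *\<^sub>C W x - l2 *\<^sub>C x) = l1 *\<^sub>C W (A x) - l2 *\<^sub>C A x"
  shows "A (R x) = R (A x)"
  by (metis R A)

lemma fibre_exact_1:
  assumes "z \<noteq> l1 * l2"
  shows "koszul_exact UNIV (\<lambda>x. T1 z x - l1 *\<^sub>C x) (\<lambda>x. T2 z x - l2 *\<^sub>C x)"
proof (rule koszul_exactI[where ?B1.0 = "\<lambda>x. (l2 / (z - l1 * l2)) *\<^sub>C x"
      and ?B2.0 = "\<lambda>x. (1 / (z - l1 * l2)) *\<^sub>C T1 z x"])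
  fix x
  have "(l2 / (z - l1 * l2)) *\<^sub>C (T1 z x - l1 *\<^sub>C x) + (1 / (z - l1 * l2)) *\<^sub>C T1 z (T2 z x - l2 *\<^sub>C x)
      = (1 / (z - l1 * l2)) *\<^sub>C (l2 *\<^sub>C (T1 z x - l1 *\<^sub>C x) + T1 z (T2 z x - l2 *\<^sub>C x))"
    by (simp only: scaleC_add_right scaleC_scaleC) simp
  also have "\<dots> = x" using assms by (simp only: combination_1 scaleC_scaleC) (simp add: scaleC_one)
  finally show "(l2 / (z - l1 * l2)) *\<^sub>C (T1 z x - l1 *\<^sub>C x) + (1 / (z - l1 * l2)) *\<^sub>C T1 z (T2 z x - l2 *\<^sub>C x) = x" .
qed (simp_all add: T1_linear W_T1[symmetric] T1_W U_simps scaleC_simps mult.commute algebra_simps)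

text \<open>Applying \<open>R\<close> to \<open>combination_2\<close> gives the coefficients
  \<open>- R W\<close> and \<open>R\<close>; \<open>R\<close> commutes with \<open>T1\<close> and
  \<open>W\<close> because the pencil does.\<close>

lemma fibre_exact_2:
  assumes "l1 = 0 \<and> l2 \<noteq> 0 \<or> l1 \<noteq> 0 \<and> l2 / l1 \<notin> \<sigma>W"
  shows "koszul_exact UNIV (\<lambda>x. T1 z x - l1 *\<^sub>C x) (\<lambda>x. T2 z x - l2 *\<^sub>C x)"
proof -
  obtain R where R: "bounded_op R" "\<And>x. R (l1 *\<^sub>C W x - l2 *\<^sub>C x) = x"
    "\<And>x. l1 *\<^sub>C W (R x) - l2 *\<^sub>C R x = x"
    using resolvent_pencil[OF assms] by blast
  interpret R: bounded_linear R by (rule bounded_op_bounded_linear[OF R(1)])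
  have R_scale: "R (c *\<^sub>C x) = c *\<^sub>C R x" for c x
    using R(1) by (simp add: bounded_op_def clinear_op_def)
  have U_minus: "U (- x) = - U x" for x
    using U_simps(2)[of "- 1" x] by (simp add: scaleC_simps)
  have RT: "T1 z (R x) = R (T1 z x)" for x
    by (rule resolvent_pencil_commute[OF R(2,3)]) (simp add: T1_linear T1_W)
  have RW: "W (R x) = R (W x)" for x
    by (rule resolvent_pencil_commute[OF R(2,3)]) (simp add: U_simps)
  show ?thesis
  proof (rule koszul_exactI[where ?B1.0 = "\<lambda>x. - R (W x)" and ?B2.0 = R])
    fix x
    have "- R (W (T1 z x - l1 *\<^sub>C x)) + R (T2 z x - l2 *\<^sub>C x)
        = R ((T2 z x - l2 *\<^sub>C x) - W (T1 z x - l1 *\<^sub>C x))"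
      by (simp add: R.diff)
    also have "\<dots> = x" by (simp only: combination_2 R(2))
    finally show "- R (W (T1 z x - l1 *\<^sub>C x)) + R (T2 z x - l2 *\<^sub>C x) = x" .
  qed (simp_all add: T1_linear W_T1[symmetric] T1_W U_simps U_minus R.add R.diff R.neg R.zero R_scale RT RW
        scaleC_simps)
qed

end

section \<open>Joint approximate eigenvectors of the adjoints\<close>

context bcl_swap
begin

text \<open>Normality of \<open>W - \<mu>\<close>: its adjoint, moved to \<open>y\<close>, has the
  same norm there as \<open>W - \<mu>\<close>. Surjectivity of \<open>W\<close> allows
  \<open>y\<close> to be written as \<open>W u\<close>.\<close>

lemma cinner_W_minus_scalar_le:
  "cmod (cinner y (W c - \<mu> *\<^sub>C c)) \<le> norm (W y - \<mu> *\<^sub>C y) * norm c"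
proof -
  note iso = W.isometry
  obtain u where u: "y = W u" using surj_W by (meson surjD)
  have "cmod (cinner y (W c - \<mu> *\<^sub>C c)) = cmod (cinner (W c - \<mu> *\<^sub>C c) (W u))"
    unfolding u by (subst cinner_commute) simp
  also have "\<dots> = cmod (cinner c (u - cnj \<mu> *\<^sub>C W u))"
    by (simp only: cinner_isometry_minus_scalar[OF iso])
  also have "\<dots> \<le> norm c * norm (W u - \<mu> *\<^sub>C u)"
    using norm_cinner_le norm_isometry_minus_scalar[OF iso] by metis
  also have "norm (W u - \<mu> *\<^sub>C u) = norm (W (W u - \<mu> *\<^sub>C u))"
    by (simp only: U_simps(5))
  also have "W (W u - \<mu> *\<^sub>C u) = W y - \<mu> *\<^sub>C y"
    by (simp add: u U_simps)
  finally show ?thesis by (simp add: mult.commute)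
qed

text \<open>For an eigenvector \<open>x\<close> of \<open>W\<close>, the vector \<open>U x + cnj w *\<^sub>C x = (T1 z)\<^sup>* x + cnj w *\<^sub>C x\<close> is a joint
  eigenvector of the adjoints of \<open>T1 z\<close> and \<open>T2 z\<close>. The estimates are the version of this for
  approximate eigenvectors.\<close>

lemma test_vector_norm:
  assumes "x \<in> range P" "cmod w \<le> 1"
  shows "norm x \<le> norm (U x + cnj w *\<^sub>C x)" "norm (U x + cnj w *\<^sub>C x) \<le> 2 * norm x"
proof -
  have Px: "P x = x" using assms(1) by (auto simp: P_simps)
  \<comment> \<open>\<open>U\<close> sends \<open>range P\<close> to its complement, so the two
    summands of the test vector are orthogonal.\<close>
  have "cinner (P x) (U x) = 0" unfolding P_simps(5) by (simp add: swap Px U_simps)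
  then have "cinner x (U x) = 0" by (simp only: Px)
  then have "cinner (U x) x = 0" using cinner_commute[of "U x" x] by simp
  then have "(norm x)\<^sup>2 \<le> (norm (U x + cnj w *\<^sub>C x))\<^sup>2"
    by (simp add: norm_add_square U_simps cinner_simps)
  then show "norm x \<le> norm (U x + cnj w *\<^sub>C x)" by (rule power2_le_imp_le) simp
  have "norm (U x + cnj w *\<^sub>C x) \<le> norm x + cmod w * norm x"
    using norm_triangle_ineq[of "U x" "cnj w *\<^sub>C x"] by (simp add: U_simps norm_scaleC)
  also have "\<dots> \<le> 2 * norm x" using mult_right_mono[OF assms(2), of "norm x"] by simp
  finally show "norm (U x + cnj w *\<^sub>C x) \<le> 2 * norm x" .
qed

lemma test_vector_estimate:
  assumes x: "x \<in> range P" and \<mu>: "cmod \<mu> = 1" and w: "cmod w \<le> 1" and z: "z = w * w * \<mu>"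
  shows "cmod (cinner (U x + cnj w *\<^sub>C x) ((T1 z a - w *\<^sub>C a) + (T2 z b - (w * \<mu>) *\<^sub>C b)))
    \<le> 3 * norm (W x - \<mu> *\<^sub>C x) * (norm a + norm b)"
proof -
  define y where "y = U x + cnj w *\<^sub>C x"
  define d where "d = norm (W x - \<mu> *\<^sub>C x)"
  have Px: "P x = x" using x by (auto simp: P_simps)
  have z1: "cmod z \<le> 1" using \<mu> w by (simp add: z norm_mult mult_le_one)
  \<comment> \<open>The adjoint of \<open>(I - P) + z P\<close> is the identity on the complement of
    \<open>range P\<close>, which contains \<open>U x\<close>. Hence the adjoint of
    \<open>T1 z\<close> sends \<open>x\<close> to \<open>U x\<close>.\<close>
  have y_v: "cinner y v = cinner x (T1 z v + w *\<^sub>C v)" for v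
  proof -
    have "cinner (U x) (P v) = cinner (P (U x)) v" by (simp only: P_simps(5))
    then have Uv: "cinner (U x) (P v) = 0" by (simp add: swap Px U_simps)
    have "cinner x (T1 z v) = cinner (U x) (U (T1 z v))" by (simp only: U_simps(6))
    also have "\<dots> = cinner (U x) v"
      using Uv by (simp only: bcl_phi1_def adj_simps(8)) (simp add: cinner_simps)
    finally show ?thesis by (simp add: y_def cinner_simps)
  qed
  \<comment> \<open>\<open>y\<close> contributes a factor \<open>T1 + w\<close>, so \<open>x\<close>
    is paired with \<open>(T1^2 - w^2) c\<close>. With \<open>W T1^2 = T2 T1 = z\<close> and
    \<open>w^2 = z * cnj \<mu>\<close>, only the defect \<open>W x - \<mu> *\<^sub>C x\<close>
    survives.\<close>
  have y_T1: "cinner y (T1 z c - w *\<^sub>C c) = z * cinner (W x - \<mu> *\<^sub>C x) c" for c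
  proof -
    have "cinner x (T1 z (T1 z c)) = cinner (W x) (W (T1 z (T1 z c)))" by (simp only: U_simps(6))
    also have "\<dots> = z * cinner (W x) c" by (simp only: W_T1 T2_T1 cinner_scaleC_right)
    finally have TT: "cinner x (T1 z (T1 z c)) = z * cinner (W x) c" .
    have "z * cnj \<mu> = w * w * (\<mu> * cnj \<mu>)" by (simp add: z)
    then have "z * cnj \<mu> = w * w" using \<mu> by (simp add: complex_norm_square[symmetric])
    then have "z * cinner (\<mu> *\<^sub>C x) c = w * w * cinner x c"
      by (simp add: cinner_simps flip: mult.assoc)
    moreover have "cinner y (T1 z c - w *\<^sub>C c) = cinner x (T1 z (T1 z c)) - w * w * cinner x c"
      by (simp add: y_v T1_linear scaleC_simps cinner_simps algebra_simps)
    ultimately show ?thesis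
      by (simp add: TT cinner_diff_left right_diff_distrib)
  qed
  \<comment> \<open>The splitting \<open>T2 - w \<mu> = (W - \<mu>) T1 + \<mu> (T1 - w)\<close>
    reduces the second operator to the first, up to a term in \<open>W - \<mu>\<close>.\<close>
  have "T2 z b - (w * \<mu>) *\<^sub>C b = (W (T1 z b) - \<mu> *\<^sub>C T1 z b) + \<mu> *\<^sub>C (T1 z b - w *\<^sub>C b)"
    by (simp add: W_T1 scaleC_simps mult.commute)
  then have "cinner y ((T1 z a - w *\<^sub>C a) + (T2 z b - (w * \<mu>) *\<^sub>C b))
      = z * cinner (W x - \<mu> *\<^sub>C x) a + cinner y (W (T1 z b) - \<mu> *\<^sub>C T1 z b)
        + \<mu> * (z * cinner (W x - \<mu> *\<^sub>C x) b)"
    by (simp only: cinner_add_right cinner_scaleC_right y_T1) simp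
  also have "cmod \<dots> \<le> cmod (z * cinner (W x - \<mu> *\<^sub>C x) a) + cmod (cinner y (W (T1 z b) - \<mu> *\<^sub>C T1 z b))
        + cmod (\<mu> * (z * cinner (W x - \<mu> *\<^sub>C x) b))"
    by (intro order_trans[OF norm_triangle_ineq] add_mono norm_triangle_ineq order_refl)
  \<comment> \<open>The 2 arises because \<open>U x\<close> and \<open>cnj w *\<^sub>C x\<close>
    each have defect at most \<open>d\<close>, while \<open>T1 z\<close> is a contraction.\<close>
  also have "\<dots> \<le> d * norm a + 2 * d * norm b + d * norm b"
  proof (intro add_mono)
    have le: "cmod (z * cinner (W x - \<mu> *\<^sub>C x) c) \<le> d * norm c" for c
    proof -
      have "cmod (z * cinner (W x - \<mu> *\<^sub>C x) c) \<le> 1 * (d * norm c)"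
        unfolding norm_mult d_def using z1 norm_cinner_le by (intro mult_mono) auto
      then show ?thesis by simp
    qed
    show "cmod (z * cinner (W x - \<mu> *\<^sub>C x) a) \<le> d * norm a" by (rule le)
    show "cmod (\<mu> * (z * cinner (W x - \<mu> *\<^sub>C x) b)) \<le> d * norm b"
      using le[of b] \<mu> by (simp add: norm_mult)
    have "W y - \<mu> *\<^sub>C y = U (W x - \<mu> *\<^sub>C x) + cnj w *\<^sub>C (W x - \<mu> *\<^sub>C x)"
      by (simp add: y_def U_simps scaleC_simps mult.commute)
    then have "norm (W y - \<mu> *\<^sub>C y) \<le> d + cmod w * d"
      using norm_triangle_ineq[of "U (W x - \<mu> *\<^sub>C x)" "cnj w *\<^sub>C (W x - \<mu> *\<^sub>C x)"]
      by (simp only: U_simps(5) norm_scaleC d_def complex_mod_cnj)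
    also have "\<dots> \<le> 2 * d" using mult_right_mono[OF w, of d] by (simp add: d_def)
    finally have "norm (W y - \<mu> *\<^sub>C y) * norm (T1 z b) \<le> 2 * d * norm b"
      using norm_T1_le[OF z1, of b] by (intro mult_mono) (auto simp: d_def)
    then show "cmod (cinner y (W (T1 z b) - \<mu> *\<^sub>C T1 z b)) \<le> 2 * d * norm b"
      using cinner_W_minus_scalar_le[of y "T1 z b" \<mu>] by linarith
  qed
  also have "\<dots> \<le> 3 * d * (norm a + norm b)"
    using mult_nonneg_nonneg[of d "norm a"] by (simp add: d_def algebra_simps)
  finally show ?thesis by (simp only: y_def d_def)
qed

text \<open>Surjectivity would make the test vectors of defect at most 1 weakly bounded. But a unit
  vector of defect below \<open>1 / t\<close> may be stretched by \<open>t\<close>, so their norms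
  are unbounded.\<close>

lemma fibre_not_exact_3:
  assumes \<mu>: "\<mu> \<in> \<sigma>W" and w: "cmod w \<le> 1" and z: "z = w * w * \<mu>"
  shows "\<not> koszul_exact_3 UNIV (\<lambda>x. T1 z x - w *\<^sub>C x) (\<lambda>x. T2 z x - (w * \<mu>) *\<^sub>C x)"
proof
  assume ex: "koszul_exact_3 UNIV (\<lambda>x. T1 z x - w *\<^sub>C x) (\<lambda>x. T2 z x - (w * \<mu>) *\<^sub>C x)"
  have \<mu>1: "cmod \<mu> = 1" by (rule W.op_spectrum_norm[OF \<mu>])
  define Y where "Y = {U x + cnj w *\<^sub>C x | x. x \<in> range P \<and> norm (W x - \<mu> *\<^sub>C x) \<le> 1}"
  have "\<exists>K. \<forall>y\<in>Y. cmod (cinner y v) \<le> K" for v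
  proof -
    obtain a b where v: "v = (T1 z a - w *\<^sub>C a) + (T2 z b - (w * \<mu>) *\<^sub>C b)"
      using ex unfolding koszul_exact_3_def by blast
    have "cmod (cinner (U x + cnj w *\<^sub>C x) v) \<le> 3 * (norm a + norm b)"
      if x: "x \<in> range P" "norm (W x - \<mu> *\<^sub>C x) \<le> 1" for x
    proof -
      have "3 * norm (W x - \<mu> *\<^sub>C x) * (norm a + norm b) \<le> 3 * 1 * (norm a + norm b)"
        using x(2) by (intro mult_right_mono mult_left_mono) auto
      then show ?thesis
        using test_vector_estimate[OF x(1) \<mu>1 w z, of a b] v by simp
    qed
    then show ?thesis unfolding Y_def by blast
  qed
  then obtain K where K: "\<And>y. y \<in> Y \<Longrightarrow> norm y \<le> K"
    using uniform_boundedness[of Y] by metis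
  define t where "t = max K 0 + 1"
  have t: "t > 0" "t > K" by (auto simp: t_def)
  obtain x where x: "x \<in> range P" "norm x = 1" "norm (W x - \<mu> *\<^sub>C x) < 1 / t"
    using \<mu> t(1) unfolding W.op_spectrum_iff_approximate_eigenvalue by (meson zero_less_divide_1_iff)
  define x' where "x' = complex_of_real t *\<^sub>C x"
  have x': "x' \<in> range P" unfolding x'_def by (rule closed_subspace_scaleC[OF W.subspace x(1)])
  have "W x' - \<mu> *\<^sub>C x' = complex_of_real t *\<^sub>C (W x - \<mu> *\<^sub>C x)"
    by (simp add: x'_def U_simps scaleC_simps mult.commute)
  then have "norm (W x' - \<mu> *\<^sub>C x') \<le> 1"
    using x(3) t(1) by (simp add: norm_scaleC field_simps)
  then have "U x' + cnj w *\<^sub>C x' \<in> Y" using x' by (auto simp: Y_def)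
  then have "norm x' \<le> K" using K test_vector_norm(1)[OF x' w] by fastforce
  then show False using t x(2) by (simp add: x'_def norm_scaleC)
qed

end

section \<open>Multipliers of the Hardy space\<close>

lemma hardy2I: "hardy_rep f c \<Longrightarrow> f \<in> hardy2"
  by (auto simp: hardy2_def)

lemma hardy2_outside: "f \<in> hardy2 \<Longrightarrow> z \<notin> ball 0 1 \<Longrightarrow> f z = 0"
  by (auto simp: hardy2_def hardy_rep_def)

text \<open>The inequality \<open>2 a b \<le> t a^2 + b^2 / t\<close> does the work of
  Cauchy-Schwarz for series; the weight \<open>t\<close> may depend on \<open>z\<close>.\<close>

lemma norm_power_scaleC_le:
  assumes "t > 0"
  shows "norm (z ^ n *\<^sub>C c) \<le> (t * ((cmod z)\<^sup>2) ^ n + (norm (c::'a::complex_inner))\<^sup>2 / t) / 2"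
proof -
  have "0 \<le> (t * cmod z ^ n - norm c)\<^sup>2 / t" using assms by simp
  also have "(t * cmod z ^ n - norm c)\<^sup>2 / t = t * (cmod z ^ n)\<^sup>2 + (norm c)\<^sup>2 / t - 2 * (cmod z ^ n * norm c)"
    using assms by (simp add: field_simps power2_eq_square)
  finally show ?thesis
    by (simp add: norm_scaleC norm_power power_mult[symmetric] mult.commute)
qed

lemma square_summable_majorant:
  fixes c :: "nat \<Rightarrow> 'a::complex_inner"
  assumes c: "summable (\<lambda>n. (norm (c n))\<^sup>2)" and z: "cmod z < 1" and t: "t > 0"
  shows "(\<lambda>n. (t * ((cmod z)\<^sup>2) ^ n + (norm (c n))\<^sup>2 / t) / 2) sums
    ((t / (1 - (cmod z)\<^sup>2) + (\<Sum>n. (norm (c n))\<^sup>2) / t) / 2)"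
proof -
  have "(cmod z)\<^sup>2 < 1" using z by (simp add: power_less_one_iff)
  then have "(\<lambda>n. t * ((cmod z)\<^sup>2) ^ n) sums (t * (1 / (1 - (cmod z)\<^sup>2)))"
    by (intro sums_mult geometric_sums) simp
  then show ?thesis
    using c by (intro sums_divide sums_add) (auto simp: summable_sums)
qed

lemma power_series_summable:
  fixes c :: "nat \<Rightarrow> 'a::chilbert_space"
  assumes c: "summable (\<lambda>n. (norm (c n))\<^sup>2)" and z: "cmod z < 1"
  shows "summable (\<lambda>n. norm (z ^ n *\<^sub>C c n))"
proof (rule summable_comparison_test'[OF sums_summable])
  show "(\<lambda>n. (1 * ((cmod z)\<^sup>2) ^ n + (norm (c n))\<^sup>2 / 1) / 2) sums
      ((1 / (1 - (cmod z)\<^sup>2) + (\<Sum>n. (norm (c n))\<^sup>2) / 1) / 2)"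
    by (rule square_summable_majorant[OF c z]) simp
  show "norm (norm (z ^ n *\<^sub>C c n)) \<le> (1 * ((cmod z)\<^sup>2) ^ n + (norm (c n))\<^sup>2 / 1) / 2" for n
    using norm_power_scaleC_le[of 1 z n "c n"] by simp
qed

text \<open>Growth of point evaluations. The exponent 1/2 is what balances the boundary
  argument.\<close>

lemma hardy2_bound:
  fixes f :: "complex \<Rightarrow> 'a::chilbert_space"
  assumes "f \<in> hardy2"
  obtains C where "\<And>z. cmod z < 1 \<Longrightarrow> norm (f z) \<le> C / sqrt (1 - (cmod z)\<^sup>2)"
proof -
  obtain c where c: "summable (\<lambda>n. (norm (c n))\<^sup>2)" "\<And>z. cmod z < 1 \<Longrightarrow> (\<lambda>n. z ^ n *\<^sub>C c n) sums f z"
    using assms by (auto simp: hardy2_def hardy_rep_def)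
  have "norm (f z) \<le> ((1 + (\<Sum>n. (norm (c n))\<^sup>2)) / 2) / sqrt (1 - (cmod z)\<^sup>2)" if z: "cmod z < 1" for z
  proof -
    \<comment> \<open>With \<open>1 - |z|^2 = t^2\<close> both summands of the majorant are of order
      \<open>1 / t\<close>.\<close>
    define t where "t = sqrt (1 - (cmod z)\<^sup>2)"
    have t: "t > 0" using z by (simp add: t_def power_less_one_iff)
    have t2: "1 - (cmod z)\<^sup>2 = t * t" using z by (simp add: t_def power_le_one)
    have "norm (f z) \<le> (\<Sum>n. norm (z ^ n *\<^sub>C c n))"
      using summable_norm[OF power_series_summable[OF c(1) z]] c(2)[OF z] by (simp add: sums_iff)
    also have "\<dots> \<le> (\<Sum>n. (t * ((cmod z)\<^sup>2) ^ n + (norm (c n))\<^sup>2 / t) / 2)"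
      by (intro suminf_le norm_power_scaleC_le t power_series_summable[OF c(1) z]
          sums_summable[OF square_summable_majorant[OF c(1) z t]])
    also have "\<dots> = (t / (1 - (cmod z)\<^sup>2) + (\<Sum>n. (norm (c n))\<^sup>2) / t) / 2"
      by (rule sums_unique[OF square_summable_majorant[OF c(1) z t], symmetric])
    also have "\<dots> = ((1 + (\<Sum>n. (norm (c n))\<^sup>2)) / 2) / t"
      using t by (simp add: t2 field_simps)
    finally show ?thesis by (simp add: t_def)
  qed
  then show ?thesis by (rule that)
qed

lemma summable_square_norm_le:
  "summable g \<Longrightarrow> (\<And>n. (norm (c n))\<^sup>2 \<le> g n) \<Longrightarrow> summable (\<lambda>n. (norm (c n))\<^sup>2)"
  by (rule summable_comparison_test'[where N=0 and g=g]) simp_all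

lemma hardy_rep_add:
  assumes f: "hardy_rep f c" and g: "hardy_rep g d"
  shows "hardy_rep (f + g) (\<lambda>n. c n + d n)"
proof -
  have "summable (\<lambda>n. 2 * (norm (c n))\<^sup>2 + 2 * (norm (d n))\<^sup>2)"
    using f g by (auto simp: hardy_rep_def intro: summable_add summable_mult)
  moreover have "(norm (c n + d n))\<^sup>2 \<le> 2 * (norm (c n))\<^sup>2 + 2 * (norm (d n))\<^sup>2" for n
    using parallelogram[of "c n" "d n"] zero_le_power2[of "norm (c n - d n)"] by linarith
  ultimately have "summable (\<lambda>n. (norm (c n + d n))\<^sup>2)"
    by (rule summable_square_norm_le)
  then show ?thesis
    using f g by (auto simp: hardy_rep_def scaleC_add_right intro: sums_add)
qed

lemma hardy2_add: "f \<in> hardy2 \<Longrightarrow> g \<in> hardy2 \<Longrightarrow> f + g \<in> hardy2"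
  unfolding hardy2_def using hardy_rep_add by blast

lemma hardy_rep_bounded_op:
  assumes f: "hardy_rep f c" and A: "bounded_op A"
  shows "hardy_rep (mult_op (\<lambda>_. A) f) (\<lambda>n. A (c n))"
proof -
  interpret A: bounded_linear A by (rule bounded_op_bounded_linear[OF A])
  have A_scale: "A (a *\<^sub>C x) = a *\<^sub>C A x" for a x
    using A by (simp add: bounded_op_def clinear_op_def)
  obtain K where K: "\<And>x. norm (A x) \<le> K * norm x" using A by (auto simp: bounded_op_def)
  have "(norm (A (c n)))\<^sup>2 \<le> K\<^sup>2 * (norm (c n))\<^sup>2" for n
    using power_mono[OF K, of "c n" 2] by (simp add: power_mult_distrib)
  moreover have "summable (\<lambda>n. K\<^sup>2 * (norm (c n))\<^sup>2)"
    using f by (auto simp: hardy_rep_def intro: summable_mult)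
  ultimately have "summable (\<lambda>n. (norm (A (c n)))\<^sup>2)"
    by (rule summable_square_norm_le[rotated])
  moreover have "(\<lambda>n. z ^ n *\<^sub>C A (c n)) sums A (f z)" if "z \<in> ball 0 1" for z
    using A.sums f that unfolding hardy_rep_def A_scale[symmetric] by blast
  ultimately show ?thesis by (simp add: hardy_rep_def mult_op_def)
qed

lemma hardy_rep_shift:
  assumes f: "hardy_rep f c"
  shows "hardy_rep (\<lambda>z. z *\<^sub>C f z) (\<lambda>n. case n of 0 \<Rightarrow> 0 | Suc m \<Rightarrow> c m)"
proof -
  have "summable (\<lambda>n. (norm (case n of 0 \<Rightarrow> 0 | Suc m \<Rightarrow> c m))\<^sup>2)"
    using f by (subst summable_Suc_iff[symmetric]) (simp add: hardy_rep_def)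
  moreover have "(\<lambda>n. z ^ n *\<^sub>C (case n of 0 \<Rightarrow> 0 | Suc m \<Rightarrow> c m)) sums (z *\<^sub>C f z)"
    if z: "z \<in> ball 0 1" for z
  proof -
    have "(\<lambda>n. z *\<^sub>C (z ^ n *\<^sub>C c n)) sums (z *\<^sub>C f z)"
      using f z by (intro bounded_linear.sums[OF bounded_linear_scaleC_right]) (auto simp: hardy_rep_def)
    then show ?thesis
      using sums_Suc[of "\<lambda>n. z ^ n *\<^sub>C (case n of 0 \<Rightarrow> 0 | Suc m \<Rightarrow> c m)" "z *\<^sub>C f z"]
      by (simp add: scaleC_scaleC)
  qed
  ultimately show ?thesis using f by (simp add: hardy_rep_def)
qed

text \<open>A perturbed contraction, in the form met by the Taylor coefficients of
  \<open>f / (z - \<kappa>)\<close>.\<close>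

lemma square_summable_recursion:
  fixes a b :: "nat \<Rightarrow> real"
  assumes q: "0 \<le> q" "q < 1" and a: "\<And>n. 0 \<le> a n" and b: "summable (\<lambda>n. (b n)\<^sup>2)"
    and rec: "\<And>n. a (Suc n) \<le> q * a n + b n"
  shows "summable (\<lambda>n. (a n)\<^sup>2)"
proof -
  text \<open>Convexity of the square, with weights \<open>q\<close> and \<open>1 - q\<close>.\<close>
  have step: "(a (Suc n))\<^sup>2 \<le> q * (a n)\<^sup>2 + (b n)\<^sup>2 / (1 - q)" for n
  proof -
    have "(a (Suc n))\<^sup>2 \<le> (q * a n + b n)\<^sup>2" using rec a by (intro power_mono)
    also have "\<dots> \<le> q * (a n)\<^sup>2 + (b n)\<^sup>2 / (1 - q)"
    proof -
      have "(1 - q) * (q * a n + b n)\<^sup>2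
          = (1 - q) * (q * (a n)\<^sup>2) + (b n)\<^sup>2 - q * ((1 - q) * a n - b n)\<^sup>2"
        by (simp add: algebra_simps power2_eq_square)
      also have "\<dots> \<le> (1 - q) * (q * (a n)\<^sup>2) + (b n)\<^sup>2" using q by simp
      also have "\<dots> = (1 - q) * (q * (a n)\<^sup>2 + (b n)\<^sup>2 / (1 - q))"
        using q by (simp add: distrib_left)
      finally show ?thesis using q by simp
    qed
    finally show ?thesis .
  qed
  define C where "C = (a 0)\<^sup>2 + (\<Sum>n. (b n)\<^sup>2) / (1 - q)"
  \<comment> \<open>Shifting the index bounds the next partial sum by \<open>C\<close> plus
    \<open>q\<close> times the present one; since \<open>q < 1\<close> the latter can be
    absorbed.\<close>
  have partial: "(\<Sum>n<m. (a n)\<^sup>2) \<le> C / (1 - q)" for m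
  proof -
    have "(\<Sum>n<Suc m. (a n)\<^sup>2) = (a 0)\<^sup>2 + (\<Sum>n<m. (a (Suc n))\<^sup>2)"
      by (rule sum.lessThan_Suc_shift)
    also have "\<dots> \<le> (a 0)\<^sup>2 + (\<Sum>n<m. q * (a n)\<^sup>2 + (b n)\<^sup>2 / (1 - q))"
      by (intro add_left_mono sum_mono step)
    also have "\<dots> = (a 0)\<^sup>2 + q * (\<Sum>n<m. (a n)\<^sup>2) + (\<Sum>n<m. (b n)\<^sup>2) / (1 - q)"
      by (simp add: sum.distrib sum_distrib_left sum_divide_distrib)
    also have "\<dots> \<le> C + q * (\<Sum>n<m. (a n)\<^sup>2)"
      using q sum_le_suminf[OF b, of "{..<m}"] by (simp add: C_def divide_right_mono)
    finally have "(\<Sum>n<m. (a n)\<^sup>2) \<le> C + q * (\<Sum>n<m. (a n)\<^sup>2)"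
      using zero_le_power2[of "a m"] unfolding sum.lessThan_Suc by linarith
    then show ?thesis using q by (simp add: field_simps)
  qed
  show ?thesis
    by (rule summableI_nonneg_bounded[OF _ partial]) simp
qed

text \<open>Invariance of the space suffices as a notion here, exactness of a Koszul complex being
  algebraic.\<close>

definition hardy_multiplier :: "(complex \<Rightarrow> 'e::chilbert_space \<Rightarrow> 'e) \<Rightarrow> bool" where
  "hardy_multiplier a \<longleftrightarrow> (\<forall>f\<in>hardy2. mult_op a f \<in> hardy2)"

lemma hardy_multiplier_bounded_op: "bounded_op A \<Longrightarrow> hardy_multiplier (\<lambda>_. A)"
  unfolding hardy_multiplier_def hardy2_def using hardy_rep_bounded_op by blast

lemma hardy_multiplier_compose:
  assumes "hardy_multiplier a" "hardy_multiplier b"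
  shows "hardy_multiplier (\<lambda>z x. a z (b z x))"
proof -
  have "mult_op (\<lambda>z x. a z (b z x)) f = mult_op a (mult_op b f)" for f
    by (auto simp: mult_op_def)
  then show ?thesis using assms by (simp add: hardy_multiplier_def)
qed

lemma hardy_multiplier_add:
  assumes "hardy_multiplier a" "hardy_multiplier b"
  shows "hardy_multiplier (\<lambda>z x. a z x + b z x)"
proof -
  have "mult_op (\<lambda>z x. a z x + b z x) f = mult_op a f + mult_op b f" for f
    by (auto simp: mult_op_def)
  then show ?thesis using assms by (auto simp: hardy_multiplier_def intro: hardy2_add)
qed

lemma bounded_op_scaleC: "bounded_op ((*\<^sub>C) c :: 'a::complex_inner \<Rightarrow> 'a)"
proof -
  have "\<exists>K. \<forall>x::'a. norm (c *\<^sub>C x) \<le> K * norm x"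
    by (rule exI[of _ "cmod c"]) (simp add: norm_scaleC)
  then show ?thesis by (simp add: bounded_op_def clinear_op_def scaleC_simps mult.commute)
qed

lemma hardy_multiplier_scaleC: "hardy_multiplier (\<lambda>_ x. c *\<^sub>C x)"
  by (rule hardy_multiplier_bounded_op[OF bounded_op_scaleC])

lemma hardy_multiplier_shift: "hardy_multiplier (\<lambda>z x. z *\<^sub>C x)"
proof -
  have "mult_op (\<lambda>z x. z *\<^sub>C x) f = (\<lambda>z. z *\<^sub>C f z)" if "f \<in> hardy2" for f :: "complex \<Rightarrow> 'a"
    using hardy2_outside[OF that] by (auto simp: mult_op_def)
  then show ?thesis
    unfolding hardy_multiplier_def hardy2_def using hardy_rep_shift by force
qed

text \<open>Comparing coefficients in \<open>(z - \<kappa>) h = f\<close> gives a recursion with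
  ratio \<open>1 / \<kappa>\<close>, a contraction because \<kappa> lies outside the closed
  disc.\<close>

lemma hardy_multiplier_resolvent:
  assumes \<kappa>: "cmod \<kappa> > 1"
  shows "hardy_multiplier (\<lambda>z x. (1 / (z - \<kappa>)) *\<^sub>C (x::'a::chilbert_space))"
  unfolding hardy_multiplier_def
proof
  fix f :: "complex \<Rightarrow> 'a" assume "f \<in> hardy2"
  then obtain c where c: "hardy_rep f c" by (auto simp: hardy2_def)
  have \<kappa>0: "\<kappa> \<noteq> 0" using \<kappa> by auto
  \<comment> \<open>Solves \<open>g (n - 1) - \<kappa> g n = c n\<close>, with 0 in place of
    \<open>g (n - 1)\<close> at \<open>n = 0\<close>.\<close>
  define g where "g = rec_nat ((- 1 / \<kappa>) *\<^sub>C c 0) (\<lambda>n y. (1 / \<kappa>) *\<^sub>C (y - c (Suc n)))"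
  have g: "g 0 = (- 1 / \<kappa>) *\<^sub>C c 0" "\<And>n. g (Suc n) = (1 / \<kappa>) *\<^sub>C (g n - c (Suc n))"
    by (simp_all add: g_def)
  define q where "q = 1 / cmod \<kappa>"
  have q: "0 \<le> q" "q < 1" using \<kappa> by (simp_all add: q_def divide_less_eq)
  have "summable (\<lambda>n. (norm (g n))\<^sup>2)"
  proof (rule square_summable_recursion[where q=q and b="\<lambda>n. q * norm (c (Suc n))"])
    have "summable (\<lambda>n. (norm (c (Suc n)))\<^sup>2)"
      using c by (subst summable_Suc_iff) (simp add: hardy_rep_def)
    then show "summable (\<lambda>n. (q * norm (c (Suc n)))\<^sup>2)"
      by (simp add: power_mult_distrib summable_mult)
    show "norm (g (Suc n)) \<le> q * norm (g n) + q * norm (c (Suc n))" for n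
    proof -
      have "norm (g (Suc n)) = q * norm (g n - c (Suc n))"
        by (simp add: g(2) norm_scaleC norm_divide q_def)
      also have "\<dots> \<le> q * (norm (g n) + norm (c (Suc n)))"
        by (intro mult_left_mono norm_triangle_ineq4 q)
      finally show ?thesis by (simp add: distrib_left)
    qed
  qed (use q in auto)
  note gs = this
  define h where "h z = (if z \<in> ball 0 1 then \<Sum>n. z ^ n *\<^sub>C g n else 0)" for z
  have h: "hardy_rep h g"
    using gs power_series_summable[OF gs, THEN summable_norm_cancel]
    by (auto simp: hardy_rep_def h_def summable_sums)
  have "mult_op (\<lambda>z x. (1 / (z - \<kappa>)) *\<^sub>C x) f = h"
  proof
    fix z
    show "mult_op (\<lambda>z x. (1 / (z - \<kappa>)) *\<^sub>C x) f z = h z"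
    proof (cases "z \<in> ball 0 1")
      case True
      from hardy_rep_add[OF hardy_rep_shift[OF h] hardy_rep_bounded_op[OF h bounded_op_scaleC[of "- \<kappa>"]]] True
      have "(\<lambda>n. z ^ n *\<^sub>C ((case n of 0 \<Rightarrow> 0 | Suc m \<Rightarrow> g m) + (- \<kappa>) *\<^sub>C g n)) sums (z *\<^sub>C h z + (- \<kappa>) *\<^sub>C h z)"
        by (simp add: hardy_rep_def mult_op_def)
      moreover have "(case n of 0 \<Rightarrow> 0 | Suc m \<Rightarrow> g m) + (- \<kappa>) *\<^sub>C g n = c n" for n
        using \<kappa>0 by (cases n) (simp_all add: g scaleC_simps)
      ultimately have "(\<lambda>n. z ^ n *\<^sub>C c n) sums (z *\<^sub>C h z + (- \<kappa>) *\<^sub>C h z)" by simp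
      moreover have "(\<lambda>n. z ^ n *\<^sub>C c n) sums f z" using c True by (simp add: hardy_rep_def)
      ultimately have "f z = z *\<^sub>C h z + (- \<kappa>) *\<^sub>C h z" by (rule sums_unique2[symmetric])
      then have fz: "f z = (z - \<kappa>) *\<^sub>C h z" by (simp add: scaleC_simps)
      have "z \<noteq> \<kappa>" using True \<kappa> by auto
      then have "(1 / (z - \<kappa>)) *\<^sub>C f z = h z"
        unfolding fz scaleC_scaleC by (simp add: scaleC_one)
      then show ?thesis using True by (simp add: mult_op_def)
    qed (simp add: mult_op_def h_def)
  qed
  then show "mult_op (\<lambda>z x. (1 / (z - \<kappa>)) *\<^sub>C x) f \<in> hardy2" using hardy2I[OF h] by simp
qed

lemma hardy2_const: "(\<lambda>z. if z \<in> ball 0 1 then v else 0) \<in> hardy2"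
proof (rule hardy2I)
  have "summable (\<lambda>n. (norm (if n = 0 then v else 0))\<^sup>2)"
    by (rule summable_finite[of "{0}"]) auto
  moreover have "(\<lambda>n. z ^ n *\<^sub>C (if n = 0 then v else 0)) sums v" for z
    using sums_If_finite[of "\<lambda>n. n = 0" "\<lambda>n. z ^ n *\<^sub>C v"]
    by (simp add: scaleC_one if_distrib[of "\<lambda>x. _ *\<^sub>C x"] cong: if_cong)
  ultimately show "hardy_rep (\<lambda>z. if z \<in> ball 0 1 then v else 0) (\<lambda>n. if n = 0 then v else 0)"
    by (simp add: hardy_rep_def)
qed

lemma koszul_exact_3_cong:
  assumes "\<And>x. x \<in> S \<Longrightarrow> A1 x = A1' x" "\<And>x. x \<in> S \<Longrightarrow> A2 x = A2' x"
  shows "koszul_exact_3 S A1 A2 \<longleftrightarrow> koszul_exact_3 S A1' A2'"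
proof -
  have "{A1 a + A2 b | a b. a \<in> S \<and> b \<in> S} = {A1' a + A2' b | a b. a \<in> S \<and> b \<in> S}"
    using assms by (metis (no_types, lifting))
  then show ?thesis by (simp add: koszul_exact_3_def)
qed

lemma koszul_exact_cong:
  assumes "\<And>x. x \<in> S \<Longrightarrow> A1 x = A1' x" "\<And>x. x \<in> S \<Longrightarrow> A2 x = A2' x"
  shows "koszul_exact S A1 A2 \<longleftrightarrow> koszul_exact S A1' A2'"
  using assms koszul_exact_3_cong[OF assms]
  unfolding koszul_exact_def koszul_exact_1_def koszul_exact_2_def by simp

lemma mult_op_minus_scale:
  assumes "f \<in> hardy2"
  shows "mult_op a f - hardy_scale l f = mult_op (\<lambda>z x. a z x - l *\<^sub>C x) f"
  using hardy2_outside[OF assms] by (auto simp: mult_op_def hardy_scale_def fun_eq_iff)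

text \<open>Multiplication acts pointwise, so fibrewise identities transfer. Restricting
  \<open>id\<close> to the disc lets a coefficient have a pole outside it.\<close>

lemma koszul_exact_hardy2I:
  fixes a1 a2 b1 b2 :: "complex \<Rightarrow> 'a::chilbert_space \<Rightarrow> 'a"
  assumes mult: "hardy_multiplier a1" "hardy_multiplier a2" "hardy_multiplier b1" "hardy_multiplier b2"
    and add: "\<And>z x y. a1 z (x + y) = a1 z x + a1 z y" "\<And>z x y. a2 z (x + y) = a2 z x + a2 z y"
    and zero: "\<And>z. b1 z 0 = 0" "\<And>z. b2 z 0 = 0"
    and comm: "\<And>z x. a1 z (b1 z x) = b1 z (a1 z x)" "\<And>z x. a1 z (b2 z x) = b2 z (a1 z x)"
      "\<And>z x. a2 z (b1 z x) = b1 z (a2 z x)" "\<And>z x. a2 z (b2 z x) = b2 z (a2 z x)"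
    and id: "\<And>z x. z \<in> ball 0 1 \<Longrightarrow> b1 z (a1 z x) + b2 z (a2 z x) = x"
  shows "koszul_exact hardy2 (mult_op a1) (mult_op a2)"
proof (rule koszul_exactI[where ?B1.0 = "mult_op b1" and ?B2.0 = "mult_op b2"])
  fix f :: "complex \<Rightarrow> 'a" assume "f \<in> hardy2"
  then have "mult_op b1 (mult_op a1 f) z + mult_op b2 (mult_op a2 f) z = f z" for z
    using id[of z "f z"] hardy2_outside[of f z] by (simp add: mult_op_def)
  then show "mult_op b1 (mult_op a1 f) + mult_op b2 (mult_op a2 f) = f"
    by (simp add: fun_eq_iff)
qed (use mult hardy2_add in \<open>auto simp: hardy_multiplier_def mult_op_def fun_eq_iff add zero comm\<close>)

section \<open>The Koszul complex on the Hardy space\<close>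

context bcl_swap
begin

lemma bounded_op_adj_compl: "bounded_op (\<lambda>x. adj U (x - P x))" "bounded_op (\<lambda>x. adj U (P x))"
proof -
  interpret P: bounded_linear P by (rule P_simps(7))
  obtain K where K: "\<And>x. norm (P x) \<le> norm x * K" using P.bounded by blast
  have "norm (x - P x) \<le> (1 + K) * norm x" for x
    using norm_triangle_ineq4[of x "P x"] K[of x] by (simp add: algebra_simps)
  then have "norm (adj U (x - P x)) \<le> (1 + K) * norm x" for x by (simp only: adj_simps(5))
  then show "bounded_op (\<lambda>x. adj U (x - P x))"
    unfolding bounded_op_def clinear_op_def
    by (intro conjI exI[of _ "1 + K"] allI) (simp_all add: adj_simps(1-3) P_simps scaleC_simps)
  have "norm (adj U (P x)) \<le> K * norm x" for x
    using K[of x] by (simp add: adj_simps(5) mult.commute)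
  then show "bounded_op (\<lambda>x. adj U (P x))"
    unfolding bounded_op_def clinear_op_def
    by (intro conjI exI[of _ K] allI) (simp_all add: adj_simps(1-3) P_simps)
qed

lemma bounded_op_W: "bounded_op W"
  using W.isometry by (simp add: isometry_op_def)

lemma hardy_multiplier_T1: "hardy_multiplier T1"
proof -
  have "T1 = (\<lambda>z x. adj U (x - P x) + z *\<^sub>C adj U (P x))"
    by (simp add: bcl_phi1_def fun_eq_iff adj_simps)
  moreover have "hardy_multiplier \<dots>"
    by (intro hardy_multiplier_add hardy_multiplier_bounded_op bounded_op_adj_compl
        hardy_multiplier_compose[OF hardy_multiplier_shift])
  ultimately show ?thesis by simp
qed

lemma hardy_multiplier_T2: "hardy_multiplier T2"
  using hardy_multiplier_compose[OF hardy_multiplier_bounded_op[OF bounded_op_W] hardy_multiplier_T1]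
  by (simp add: W_T1)

lemma hardy_multiplier_minus_scaleC:
  assumes "hardy_multiplier a"
  shows "hardy_multiplier (\<lambda>z x. a z x - l *\<^sub>C (x::'e))"
  using hardy_multiplier_add[OF assms hardy_multiplier_scaleC[of "- l"]] by (simp add: scaleC_simps)

abbreviation "M1 l \<equiv> \<lambda>f. mult_op T1 f - hardy_scale l f"
abbreviation "M2 l \<equiv> \<lambda>f. mult_op T2 f - hardy_scale l f"

lemma hardy_exact_1:
  assumes "cmod (l1 * l2) > 1"
  shows "koszul_exact hardy2 (M1 l1) (M2 l2)"
proof -
  have "koszul_exact hardy2 (mult_op (\<lambda>z x. T1 z x - l1 *\<^sub>C x)) (mult_op (\<lambda>z x. T2 z x - l2 *\<^sub>C x))"
  proof (rule koszul_exact_hardy2I[where ?b1.0 = "\<lambda>z x. l2 *\<^sub>C ((1 / (z - l1 * l2)) *\<^sub>C x)"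
        and ?b2.0 = "\<lambda>z x. (1 / (z - l1 * l2)) *\<^sub>C T1 z x"])
    show "hardy_multiplier (\<lambda>z x. T1 z x - l1 *\<^sub>C x)" "hardy_multiplier (\<lambda>z x. T2 z x - l2 *\<^sub>C x)"
      by (intro hardy_multiplier_minus_scaleC hardy_multiplier_T1 hardy_multiplier_T2)+
    show "hardy_multiplier (\<lambda>z x. l2 *\<^sub>C ((1 / (z - l1 * l2)) *\<^sub>C (x::'e)))"
      by (rule hardy_multiplier_compose[OF hardy_multiplier_scaleC hardy_multiplier_resolvent[OF assms]])
    show "hardy_multiplier (\<lambda>z x. (1 / (z - l1 * l2)) *\<^sub>C T1 z x)"
      by (rule hardy_multiplier_compose[OF hardy_multiplier_resolvent[OF assms] hardy_multiplier_T1])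
    fix z :: complex and x assume "z \<in> ball 0 1"
    then have z: "z \<noteq> l1 * l2" using assms by auto
    have "l2 *\<^sub>C ((1 / (z - l1 * l2)) *\<^sub>C (T1 z x - l1 *\<^sub>C x)) + (1 / (z - l1 * l2)) *\<^sub>C T1 z (T2 z x - l2 *\<^sub>C x)
        = (1 / (z - l1 * l2)) *\<^sub>C (l2 *\<^sub>C (T1 z x - l1 *\<^sub>C x) + T1 z (T2 z x - l2 *\<^sub>C x))"
      by (simp only: scaleC_add_right scaleC_scaleC) simp
    also have "\<dots> = x" using z by (simp only: combination_1 scaleC_scaleC) (simp add: scaleC_one)
    finally show "l2 *\<^sub>C ((1 / (z - l1 * l2)) *\<^sub>C (T1 z x - l1 *\<^sub>C x))
        + (1 / (z - l1 * l2)) *\<^sub>C T1 z (T2 z x - l2 *\<^sub>C x) = x" .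
  qed (simp_all add: T1_linear W_T1[symmetric] T1_W U_simps scaleC_simps mult.commute algebra_simps)
  then show ?thesis
    using koszul_exact_cong[of hardy2 "M1 l1" "mult_op (\<lambda>z x. T1 z x - l1 *\<^sub>C x)" "M2 l2"
        "mult_op (\<lambda>z x. T2 z x - l2 *\<^sub>C x)"] by (simp add: mult_op_minus_scale)
qed

text \<open>The fibre coefficients \<open>- R W\<close> and \<open>R\<close> are constant in
  \<open>z\<close>, so they act on the Hardy space whatever the product \<open>l1 * l2\<close>
  is.\<close>

lemma hardy_exact_2:
  assumes "l1 = 0 \<and> l2 \<noteq> 0 \<or> l1 \<noteq> 0 \<and> l2 / l1 \<notin> \<sigma>W"
  shows "koszul_exact hardy2 (M1 l1) (M2 l2)"
proof -
  obtain R where R: "bounded_op R" "\<And>x. R (l1 *\<^sub>C W x - l2 *\<^sub>C x) = x"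
    "\<And>x. l1 *\<^sub>C W (R x) - l2 *\<^sub>C R x = x"
    using resolvent_pencil[OF assms] by blast
  interpret R: bounded_linear R by (rule bounded_op_bounded_linear[OF R(1)])
  have R_scale: "R (c *\<^sub>C x) = c *\<^sub>C R x" for c x
    using R(1) by (simp add: bounded_op_def clinear_op_def)
  have RT: "T1 z (R x) = R (T1 z x)" for x z
    by (rule resolvent_pencil_commute[OF R(2,3)]) (simp add: T1_linear T1_W)
  have RW: "W (R x) = R (W x)" for x
    by (rule resolvent_pencil_commute[OF R(2,3)]) (simp add: U_simps)
  have U_minus: "U (- x) = - U x" for x
    using U_simps(2)[of "- 1" x] by (simp add: scaleC_simps)
  have "koszul_exact hardy2 (mult_op (\<lambda>z x. T1 z x - l1 *\<^sub>C x)) (mult_op (\<lambda>z x. T2 z x - l2 *\<^sub>C x))"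
  proof (rule koszul_exact_hardy2I[where ?b1.0 = "\<lambda>z x. (- 1) *\<^sub>C R (W x)" and ?b2.0 = "\<lambda>_. R"])
    show "hardy_multiplier (\<lambda>z x. T1 z x - l1 *\<^sub>C x)" "hardy_multiplier (\<lambda>z x. T2 z x - l2 *\<^sub>C x)"
      by (intro hardy_multiplier_minus_scaleC hardy_multiplier_T1 hardy_multiplier_T2)+
    show "hardy_multiplier (\<lambda>z x. (- 1) *\<^sub>C R (W x))"
      by (intro hardy_multiplier_compose[OF hardy_multiplier_scaleC]
          hardy_multiplier_compose[OF hardy_multiplier_bounded_op[OF R(1)]]
          hardy_multiplier_bounded_op bounded_op_W)
    show "hardy_multiplier (\<lambda>_. R)" by (rule hardy_multiplier_bounded_op[OF R(1)])
    fix z x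
    have "(- 1) *\<^sub>C R (W (T1 z x - l1 *\<^sub>C x)) + R (T2 z x - l2 *\<^sub>C x)
        = R ((T2 z x - l2 *\<^sub>C x) - W (T1 z x - l1 *\<^sub>C x))"
      by (simp add: R.diff scaleC_simps)
    also have "\<dots> = x" by (simp only: combination_2 R(2))
    finally show "(- 1) *\<^sub>C R (W (T1 z x - l1 *\<^sub>C x)) + R (T2 z x - l2 *\<^sub>C x) = x" .
  qed (simp_all add: T1_linear W_T1[symmetric] T1_W U_simps U_minus R.add R.diff R.neg R.zero R_scale RT RW
        scaleC_simps)
  then show ?thesis
    using koszul_exact_cong[of hardy2 "M1 l1" "mult_op (\<lambda>z x. T1 z x - l1 *\<^sub>C x)" "M2 l2"
        "mult_op (\<lambda>z x. T2 z x - l2 *\<^sub>C x)"] by (simp add: mult_op_minus_scale)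
qed

text \<open>Writing one constant function in stage-3 form solves all fibres at once, by values of
  two Hardy functions whose growth is known.\<close>

lemma hardy_exact_3_eval:
  assumes "koszul_exact_3 hardy2 (M1 l1) (M2 l2)"
  obtains f g where "f \<in> hardy2" "g \<in> hardy2"
    "\<And>z. z \<in> ball 0 1 \<Longrightarrow> v = (T1 z (f z) - l1 *\<^sub>C f z) + (T2 z (g z) - l2 *\<^sub>C g z)"
proof -
  have "(\<lambda>z. if z \<in> ball 0 1 then v else 0) \<in> {M1 l1 f + M2 l2 g | f g. f \<in> hardy2 \<and> g \<in> hardy2}"
    using assms hardy2_const[of v] unfolding koszul_exact_3_def by blast
  then obtain f g where fg: "f \<in> hardy2" "g \<in> hardy2"
    "(\<lambda>z. if z \<in> ball 0 1 then v else 0) = M1 l1 f + M2 l2 g" by blast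
  have "v = (T1 z (f z) - l1 *\<^sub>C f z) + (T2 z (g z) - l2 *\<^sub>C g z)" if "z \<in> ball 0 1" for z
    using fun_cong[OF fg(3), of z] that by (simp add: mult_op_def hardy_scale_def)
  with fg(1,2) show ?thesis by (rule that)
qed

lemma hardy_not_exact_3_interior:
  assumes \<mu>: "\<mu> \<in> \<sigma>W" and w: "cmod w < 1"
  shows "\<not> koszul_exact_3 hardy2 (M1 w) (M2 (w * \<mu>))"
proof
  assume ex: "koszul_exact_3 hardy2 (M1 w) (M2 (w * \<mu>))"
  define z where "z = w * w * \<mu>"
  have "cmod w * cmod w < 1 * 1" using w by (intro mult_strict_mono') auto
  then have z: "z \<in> ball 0 1" using W.op_spectrum_norm[OF \<mu>] by (simp add: z_def norm_mult)
  have "\<exists>a b. v = (T1 z a - w *\<^sub>C a) + (T2 z b - (w * \<mu>) *\<^sub>C b)" for v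
    using hardy_exact_3_eval[OF ex, of v] z by metis
  then have "koszul_exact_3 UNIV (\<lambda>x. T1 z x - w *\<^sub>C x) (\<lambda>x. T2 z x - (w * \<mu>) *\<^sub>C x)"
    unfolding koszul_exact_3_def by auto
  then show False
    using fibre_not_exact_3[OF \<mu> _ z_def] w by simp
qed

text \<open>On the boundary, evaluation at \<open>r\<^sup>2 w\<^sup>2 \<mu>\<close> for \<open>r\<close> tending to 1 costs only a factor \<open>(1 - r)\<^bsup>-1/2\<^esup>\<close>,
  whereas \<open>r w\<close> has distance \<open>1 - r\<close> from \<open>w\<close>. So the test vectors at \<open>r w\<close>, rescaled by
  \<open>(1 - r)\<^bsup>-1/2\<^esup>\<close>, would be an unbounded but weakly bounded family.\<close>

lemma hardy_not_exact_3_boundary: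
  assumes \<mu>: "\<mu> \<in> \<sigma>W" and w: "cmod w = 1"
  shows "\<not> koszul_exact_3 hardy2 (M1 w) (M2 (w * \<mu>))"
proof
  assume ex: "koszul_exact_3 hardy2 (M1 w) (M2 (w * \<mu>))"
  have \<mu>1: "cmod \<mu> = 1" by (rule W.op_spectrum_norm[OF \<mu>])
  define u where "u r = complex_of_real r * w" for r
  \<comment> \<open>The small defect is to absorb the growth of \<open>f\<close> and
    \<open>g\<close> near the boundary, while the norm bound still tends to infinity as
    \<open>r\<close> tends to 1.\<close>
  define Y where "Y = {U x + cnj (u r) *\<^sub>C x | x r. x \<in> range P \<and> 0 \<le> r \<and> r < 1 \<and>
    norm (W x - \<mu> *\<^sub>C x) \<le> sqrt (1 - r) \<and> norm x \<le> 1 / sqrt (1 - r)}"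
  have "\<exists>K. \<forall>y\<in>Y. cmod (cinner y v) \<le> K" for v
  proof -
    obtain f g where fg: "f \<in> hardy2" "g \<in> hardy2"
      "\<And>z. z \<in> ball 0 1 \<Longrightarrow> v = (T1 z (f z) - w *\<^sub>C f z) + (T2 z (g z) - (w * \<mu>) *\<^sub>C g z)"
      using hardy_exact_3_eval[OF ex, of v] by blast
    obtain C where C: "\<And>z. cmod z < 1 \<Longrightarrow> norm (f z) \<le> C / sqrt (1 - (cmod z)\<^sup>2)"
      using hardy2_bound[OF fg(1)] by blast
    obtain D where D: "\<And>z. cmod z < 1 \<Longrightarrow> norm (g z) \<le> D / sqrt (1 - (cmod z)\<^sup>2)"
      using hardy2_bound[OF fg(2)] by blast
    have "cmod (cinner y v) \<le> 5 * (C + D)"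
      if y: "y = U x + cnj (u r) *\<^sub>C x" and x: "x \<in> range P" and r: "0 \<le> r" "r < 1"
        and eig: "norm (W x - \<mu> *\<^sub>C x) \<le> sqrt (1 - r)" and nx: "norm x \<le> 1 / sqrt (1 - r)" for x r y
    proof -
      define z where "z = u r * u r * \<mu>"
      define s where "s = sqrt (1 - r)"
      have s: "s > 0" "s * s = 1 - r" using r by (simp_all add: s_def)
      have ur: "cmod (u r) = r" using r w by (simp add: u_def norm_mult)
      have zr: "cmod z = r * r" using ur \<mu>1 by (simp add: z_def norm_mult)
      have r2: "r * r \<le> r" using r mult_left_le[of r r] by simp
      then have z1: "cmod z < 1" using zr r by simp
      have "(cmod z)\<^sup>2 \<le> cmod z" using z1 by (simp add: power2_eq_square mult_left_le)
      then have "1 - r \<le> 1 - (cmod z)\<^sup>2" using zr r2 by simp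
      \<comment> \<open>From \<open>|z|^2 \<le> |z| = r^2 \<le> r\<close>: evaluation at
        \<open>z\<close> costs at most a factor \<open>1 / s\<close>.\<close>
      then have sz: "s \<le> sqrt (1 - (cmod z)\<^sup>2)" by (simp add: s_def)
      have CD: "0 \<le> C" "0 \<le> D"
        using C[of 0] D[of 0] by (auto intro: order_trans[OF norm_ge_zero])
      define n where "n = norm (f z) + norm (g z)"
      have "norm (f z) \<le> C / s"
        using C[OF z1] divide_left_mono[OF sz CD(1)] s(1) sz by (smt (verit) mult_pos_pos)
      moreover have "norm (g z) \<le> D / s"
        using D[OF z1] divide_left_mono[OF sz CD(2)] s(1) sz by (smt (verit) mult_pos_pos)
      ultimately have n: "n \<le> (C + D) / s" by (simp add: n_def add_divide_distrib)
      have n0: "0 \<le> n" by (simp add: n_def)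
      \<comment> \<open>The same expression with \<open>u r\<close> in place of \<open>w\<close>,
        where the estimate for test vectors applies; the error is
        \<open>(w - u r) v2\<close>.\<close>
      define v1 where "v1 = (T1 z (f z) - u r *\<^sub>C f z) + (T2 z (g z) - (u r * \<mu>) *\<^sub>C g z)"
      define v2 where "v2 = f z + \<mu> *\<^sub>C g z"
      have "v = v1 - (w - u r) *\<^sub>C v2"
        using fg(3)[of z] z1 by (simp add: v1_def v2_def scaleC_simps algebra_simps)
      then have "cmod (cinner y v) \<le> cmod (cinner y v1) + cmod (w - u r) * cmod (cinner y v2)"
        using norm_triangle_ineq4[of "cinner y v1" "(w - u r) * cinner y v2"]
        by (simp add: cinner_simps norm_mult)
      also have "cmod (cinner y v1) \<le> 3 * s * n"
      proof -
        have "cmod (u r) \<le> 1" using ur r by simp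
        from test_vector_estimate[OF x \<mu>1 this z_def, of "f z" "g z"]
        have "cmod (cinner y v1) \<le> 3 * norm (W x - \<mu> *\<^sub>C x) * n"
          by (simp add: y v1_def n_def)
        also have "\<dots> \<le> 3 * s * n" using eig n0 by (intro mult_right_mono) (auto simp: s_def)
        finally show ?thesis .
      qed
      also have "cmod (w - u r) * cmod (cinner y v2) \<le> (s * s) * (2 / s * n)"
      proof (intro mult_mono)
        have "w - u r = complex_of_real (1 - r) * w" by (simp add: u_def algebra_simps)
        then have "cmod (w - u r) = \<bar>1 - r\<bar>" using w by (simp add: norm_mult del: of_real_diff)
        then show "cmod (w - u r) \<le> s * s" using r s(2) by simp
        have "norm y \<le> 2 * norm x"
          unfolding y using test_vector_norm(2)[OF x, of "u r"] ur r by simp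
        also have "\<dots> \<le> 2 / s" using nx by (simp add: s_def)
        finally have "norm y \<le> 2 / s" .
        moreover have "norm v2 \<le> n"
          using norm_triangle_ineq[of "f z" "\<mu> *\<^sub>C g z"] \<mu>1 by (simp add: v2_def n_def norm_scaleC)
        ultimately have "norm y * norm v2 \<le> 2 / s * n" using s(1) by (intro mult_mono) auto
        then show "cmod (cinner y v2) \<le> 2 / s * n" using norm_cinner_le[of y v2] by linarith
      qed (use s r in auto)
      \<comment> \<open>3 comes from \<open>test_vector_estimate\<close>, 2 from
        \<open>norm y \<le> 2 * norm x\<close>. The distance \<open>s^2\<close> cancels the factor
        \<open>1 / s\<close> in the norm, and the remaining \<open>s\<close> cancels the growth of
        \<open>n\<close>.\<close>
      also have "3 * s * n + (s * s) * (2 / s * n) = 5 * (s * n)" using s(1) by (simp add: field_simps)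
      also have "s * n \<le> C + D" using n s(1) by (simp add: field_simps)
      finally show ?thesis by simp
    qed
    then show ?thesis unfolding Y_def by blast
  qed
  then obtain K where K: "\<And>y. y \<in> Y \<Longrightarrow> norm y \<le> K"
    using uniform_boundedness[of Y] by metis
  define t where "t = max K 0 + 1"
  have t: "t \<ge> 1" "t > K" by (auto simp: t_def)
  \<comment> \<open>Chosen so that \<open>1 / sqrt (1 - r) = t\<close>: the vector stretched by
    \<open>t\<close> has exactly the admissible norm, and a defect below \<open>1 / t^2\<close>
    becomes one below \<open>1 / t\<close>.\<close>
  define r where "r = 1 - 1 / (t * t)"
  have t2: "t * t \<ge> 1" using mult_mono[of 1 t 1 t] t(1) by simp
  have r: "0 \<le> r" "r < 1" using t2 by (simp_all add: r_def)
  have sr: "sqrt (1 - r) = 1 / t" using t(1) by (simp add: r_def real_sqrt_divide)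
  obtain x where x: "x \<in> range P" "norm x = 1" "norm (W x - \<mu> *\<^sub>C x) < 1 / (t * t)"
    using \<mu> t2 unfolding W.op_spectrum_iff_approximate_eigenvalue
    by (meson zero_less_divide_1_iff less_le_trans zero_less_one)
  define x' where "x' = complex_of_real t *\<^sub>C x"
  have x': "x' \<in> range P" unfolding x'_def by (rule closed_subspace_scaleC[OF W.subspace x(1)])
  have "W x' - \<mu> *\<^sub>C x' = complex_of_real t *\<^sub>C (W x - \<mu> *\<^sub>C x)"
    by (simp add: x'_def U_simps scaleC_simps mult.commute)
  then have "norm (W x' - \<mu> *\<^sub>C x') \<le> 1 / t"
    using x(3) t(1) by (simp add: norm_scaleC field_simps)
  moreover have nx': "norm x' = t" using t(1) x(2) by (simp add: x'_def norm_scaleC)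
  ultimately have "U x' + cnj (u r) *\<^sub>C x' \<in> Y"
    unfolding Y_def mem_Collect_eq using x' r by (intro exI[of _ x'] exI[of _ r]) (simp add: sr)
  then have "norm (U x' + cnj (u r) *\<^sub>C x') \<le> K" by (rule K)
  moreover have "cmod (u r) \<le> 1" using r w by (simp add: u_def norm_mult)
  ultimately show False using test_vector_norm(1)[OF x', of "u r"] nx' t(2) by linarith
qed

section \<open>The joint spectra and the closure of their union\<close>

lemma fibre_spectrum:
  assumes ne: "range P \<noteq> {0}" and z: "z \<in> ball 0 1"
  shows "taylor_spectrum UNIV scaleC (T1 z) (T2 z) = {(w, w * \<mu>) | w \<mu>. \<mu> \<in> \<sigma>W \<and> z = w * w * \<mu>}"
    and "l \<in> taylor_spectrum UNIV scaleC (T1 z) (T2 z) \<Longrightarrow> koszul_breaks_3 UNIV scaleC (T1 z) (T2 z) l"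
proof -
  have breaks: "koszul_breaks_3 UNIV scaleC (T1 z) (T2 z) (w, w * \<mu>)" if "\<mu> \<in> \<sigma>W" "z = w * w * \<mu>" for w \<mu>
  proof -
    have "cmod w * cmod w \<le> 1"
      using z that W.op_spectrum_norm[of \<mu>] by (simp add: norm_mult)
    then have "cmod w \<le> 1" by (simp add: abs_square_le_1[of "cmod w", unfolded power2_eq_square, simplified])
    then show ?thesis
      using fibre_not_exact_3[OF that(1) _ that(2)] by (simp add: koszul_breaks_3_def)
  qed
  show eq: "taylor_spectrum UNIV scaleC (T1 z) (T2 z) = {(w, w * \<mu>) | w \<mu>. \<mu> \<in> \<sigma>W \<and> z = w * w * \<mu>}"
  proof (intro equalityI subsetI)
    fix l assume "l \<in> taylor_spectrum UNIV scaleC (T1 z) (T2 z)"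
    then obtain l1 l2 where l: "l = (l1, l2)"
      "\<not> koszul_exact UNIV (\<lambda>x. T1 z x - l1 *\<^sub>C x) (\<lambda>x. T2 z x - l2 *\<^sub>C x)"
      by (auto simp: taylor_spectrum_def)
    have z_eq: "z = l1 * l2" using fibre_exact_1 l(2) by blast
    have cases: "\<not> (l1 = 0 \<and> l2 \<noteq> 0 \<or> l1 \<noteq> 0 \<and> l2 / l1 \<notin> \<sigma>W)" using fibre_exact_2 l(2) by blast
    show "l \<in> {(w, w * \<mu>) | w \<mu>. \<mu> \<in> \<sigma>W \<and> z = w * w * \<mu>}"
    proof (cases "l1 = 0")
      case True
      \<comment> \<open>\<open>cases\<close> forces \<open>l2 = 0\<close>, and then any spectral
        value represents the point (0, 0).\<close>
      moreover obtain \<mu> where "\<mu> \<in> \<sigma>W" using W.op_spectrum_nonempty[OF ne] by blast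
      ultimately show ?thesis using cases l(1) z_eq by auto
    next
      case False
      then have "l2 / l1 \<in> \<sigma>W" "l = (l1, l1 * (l2 / l1))" "z = l1 * l1 * (l2 / l1)"
        using cases l(1) z_eq by auto
      then show ?thesis by blast
    qed
  next
    fix l assume "l \<in> {(w, w * \<mu>) | w \<mu>. \<mu> \<in> \<sigma>W \<and> z = w * w * \<mu>}"
    then show "l \<in> taylor_spectrum UNIV scaleC (T1 z) (T2 z)"
      using breaks by (auto simp: taylor_spectrum_def koszul_breaks_3_def koszul_exact_def)
  qed
  show "koszul_breaks_3 UNIV scaleC (T1 z) (T2 z) l" if "l \<in> taylor_spectrum UNIV scaleC (T1 z) (T2 z)"
    using that breaks unfolding eq by blast
qed

lemma hardy_spectrum:
  assumes ne: "range P \<noteq> {0}"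
  shows "taylor_spectrum hardy2 hardy_scale (mult_op T1) (mult_op T2)
    = {(w, w * \<mu>) | w \<mu>. w \<in> cball 0 1 \<and> \<mu> \<in> \<sigma>W}"
proof (intro equalityI subsetI)
  fix l assume "l \<in> taylor_spectrum hardy2 hardy_scale (mult_op T1) (mult_op T2)"
  then obtain l1 l2 where l: "l = (l1, l2)" "\<not> koszul_exact hardy2 (M1 l1) (M2 l2)"
    by (auto simp: taylor_spectrum_def)
  have le: "cmod (l1 * l2) \<le> 1" using hardy_exact_1 l(2) not_less by blast
  have cases: "\<not> (l1 = 0 \<and> l2 \<noteq> 0 \<or> l1 \<noteq> 0 \<and> l2 / l1 \<notin> \<sigma>W)" using hardy_exact_2 l(2) by blast
  show "l \<in> {(w, w * \<mu>) | w \<mu>. w \<in> cball 0 1 \<and> \<mu> \<in> \<sigma>W}"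
  proof (cases "l1 = 0")
    case True
    moreover obtain \<mu> where "\<mu> \<in> \<sigma>W" using W.op_spectrum_nonempty[OF ne] by blast
    ultimately show ?thesis using cases l(1) by auto
  next
    case False
    then have \<mu>: "l2 / l1 \<in> \<sigma>W" "l = (l1, l1 * (l2 / l1))" using cases l(1) by auto
    \<comment> \<open>Spectral values are unimodular, so the bound on the product becomes a bound on
      each coordinate.\<close>
    have "cmod l2 = cmod l1" using W.op_spectrum_norm[OF \<mu>(1)] False by (simp add: norm_divide)
    then have "(cmod l1)\<^sup>2 \<le> 1" using le by (simp add: norm_mult power2_eq_square)
    then have "l1 \<in> cball 0 1" using abs_square_le_1[of "cmod l1"] by simp
    with \<mu> show ?thesis by blast
  qed
next
  fix l assume "l \<in> {(w, w * \<mu>) | w \<mu>. w \<in> cball 0 1 \<and> \<mu> \<in> \<sigma>W}"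
  then obtain w \<mu> where l: "l = (w, w * \<mu>)" "cmod w \<le> 1" "\<mu> \<in> \<sigma>W" by auto
  have "\<not> koszul_exact_3 hardy2 (M1 w) (M2 (w * \<mu>))"
    using hardy_not_exact_3_interior[OF l(3), of w] hardy_not_exact_3_boundary[OF l(3), of w] l(2)
    by linarith
  then show "l \<in> taylor_spectrum hardy2 hardy_scale (mult_op T1) (mult_op T2)"
    by (simp add: l(1) taylor_spectrum_def koszul_exact_def)
qed

text \<open>The right side is the image of a product of compact sets. Conversely \<open>w\<close> is
  approached along its radius: for \<open>r < 1\<close> the point \<open>r w\<close> lies over
  \<open>(r w)^2 \<mu>\<close> in the open disc.\<close>

lemma closure_fibre_spectra:
  assumes ne: "range P \<noteq> {0}"
  shows "closure (\<Union>z\<in>ball 0 1. taylor_spectrum UNIV scaleC (T1 z) (T2 z))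
    = {(w, w * \<mu>) | w \<mu>. w \<in> cball 0 1 \<and> \<mu> \<in> \<sigma>W}" (is "closure ?A = ?B")
proof
  have "compact \<sigma>W"
    using W.closed_op_spectrum W.op_spectrum_norm
    by (auto simp: compact_eq_bounded_closed bounded_iff intro!: exI[of _ 1])
  then have "compact (cball (0::complex) 1 \<times> \<sigma>W)" by (intro compact_Times compact_cball)
  then have "compact ((\<lambda>(w, \<mu>). (w, w * \<mu>)) ` (cball 0 1 \<times> \<sigma>W))"
    by (intro compact_continuous_image) (auto simp: case_prod_unfold intro!: continuous_intros)
  moreover have "(\<lambda>(w, \<mu>). (w, w * \<mu>)) ` (cball 0 1 \<times> \<sigma>W) = ?B" by auto
  ultimately have "closed ?B" using compact_imp_closed by simp
  moreover have "?A \<subseteq> ?B"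
  proof
    fix l assume "l \<in> ?A"
    then obtain z where z: "z \<in> ball 0 1" "l \<in> taylor_spectrum UNIV scaleC (T1 z) (T2 z)" by blast
    then obtain w \<mu> where w: "l = (w, w * \<mu>)" "\<mu> \<in> \<sigma>W" "z = w * w * \<mu>"
      using fibre_spectrum(1)[OF ne] by blast
    then have "(cmod w)\<^sup>2 \<le> 1"
      using z(1) W.op_spectrum_norm[of \<mu>] by (simp add: norm_mult power2_eq_square)
    then have "w \<in> cball 0 1" using abs_square_le_1[of "cmod w"] by simp
    with w show "l \<in> ?B" by blast
  qed
  ultimately show "closure ?A \<subseteq> ?B" by (rule closure_minimal[rotated])
  show "?B \<subseteq> closure ?A"
  proof
    fix l assume "l \<in> ?B"
    then obtain w \<mu> where l: "l = (w, w * \<mu>)" "cmod w \<le> 1" "\<mu> \<in> \<sigma>W" by auto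
    define r where "r n = 1 - inverse (real (Suc n))" for n
    have r: "0 \<le> r n" "r n < 1" for n by (simp_all add: r_def field_simps)
    define v where "v n = complex_of_real (r n) * w" for n
    have "r \<longlonglongrightarrow> 1 - 0"
      unfolding r_def by (intro tendsto_intros LIMSEQ_inverse_real_of_nat)
    then have "(\<lambda>n. complex_of_real (r n)) \<longlonglongrightarrow> complex_of_real 1"
      by (intro tendsto_of_real) simp
    then have "v \<longlonglongrightarrow> 1 * w" unfolding v_def by (intro tendsto_intros) simp
    then have "(\<lambda>n. (v n, v n * \<mu>)) \<longlonglongrightarrow> (1 * w, 1 * w * \<mu>)" by (intro tendsto_intros)
    moreover have "(v n, v n * \<mu>) \<in> ?A" for n
    proof -
      have "cmod (v n) \<le> r n" using r[of n] l(2) by (simp add: v_def norm_mult mult_left_le)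
      then have "cmod (v n) * cmod (v n) \<le> r n * r n" using r[of n] by (intro mult_mono) auto
      also have "\<dots> < 1" using r[of n] mult_strict_mono'[of "r n" 1 "r n" 1] by simp
      finally have "v n * v n * \<mu> \<in> ball 0 1"
        using W.op_spectrum_norm[OF l(3)] by (simp add: norm_mult)
      moreover have "(v n, v n * \<mu>) \<in> taylor_spectrum UNIV scaleC (T1 (v n * v n * \<mu>)) (T2 (v n * v n * \<mu>))"
        unfolding fibre_spectrum(1)[OF ne calculation] using l(3) by blast
      ultimately show ?thesis by blast
    qed
    ultimately show "l \<in> closure ?A"
      unfolding closure_sequential l(1) by (intro exI[of _ "\<lambda>n. (v n, v n * \<mu>)"]) simp
  qed
qed

end

section \<open>The swap and the non-degeneracy of the BCL triple\<close>

lemma closed_subspace_orthogonal_disjoint: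
  assumes "\<forall>x\<in>Hp. \<forall>y\<in>Hu. cinner x y = 0" "x \<in> Hp" "x \<in> Hu"
  shows "x = 0"
  using assms cinner_eq_zero_iff by blast

text \<open>In \<open>V1 h = V2 a + V2 b\<close> the term \<open>V2 b\<close> lies in both
  orthogonal summands and vanishes, so the component \<open>a\<close> in \<open>Hp\<close> is
  already a preimage.\<close>

lemma range_restrict_subset:
  assumes V: "isometry_op V1" "isometry_op V2" and ran: "range V1 \<subseteq> range V2"
    and Hp: "closed_subspace Hp"
    and orth: "\<forall>x\<in>Hp. \<forall>y\<in>Hu. cinner x y = 0" and dec: "\<forall>h. \<exists>a\<in>Hp. \<exists>b\<in>Hu. h = a + b"
    and inv: "V1 ` Hp \<subseteq> Hp" "V2 ` Hp \<subseteq> Hp" "V2 ` Hu \<subseteq> Hu"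
    and h: "h \<in> Hp"
  shows "\<exists>k\<in>Hp. V1 h = V2 k"
proof -
  obtain k where k: "V1 h = V2 k" using ran by blast
  obtain a b where ab: "a \<in> Hp" "b \<in> Hu" "k = a + b" using dec by blast
  have "V1 h - V2 a = V2 b"
    using k ab(3) by (simp add: isometry_op_simps(1)[OF V(2)])
  moreover have "V1 h - V2 a \<in> Hp"
    using inv h ab(1) closed_subspace_diff[OF Hp] by blast
  moreover have "V2 b \<in> Hu" using inv(3) ab(2) by blast
  ultimately have "V1 h - V2 a = 0"
    using closed_subspace_orthogonal_disjoint[OF orth] by metis
  then show ?thesis using ab(1) by auto
qed

text \<open>Constant functions are in the Hardy space, so comparing the ranges of the two multiplication operators
  at \<open>z = 0\<close> compares the ranges of \<open>U\<^sup>* (I - P)\<close> and \<open>P U\<close>.\<close>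

lemma bcl_triple_swap:
  assumes V: "isometry_op V1" "isometry_op V2" and ran: "range V1 = range V2"
    and bcl: "bcl_triple V1 V2 P (U :: 'e::chilbert_space \<Rightarrow> 'e)"
  shows "bcl_swap P U"
proof -
  have P: "projection_op P" and U: "unitary_op U"
    using bcl by (auto simp: bcl_triple_def)
  note P_simps = projection_op_simps[OF P]
  note adj = unitary_op_adj[OF U]
  have isoU: "isometry_op U" using U by (simp add: unitary_op_def)
  note U_simps = isometry_op_simps[OF isoU]
  obtain Hp Hu and W :: "'a \<Rightarrow> complex \<Rightarrow> 'e" where
    H: "closed_subspace Hp"
      "\<forall>x\<in>Hp. \<forall>y\<in>Hu. cinner x y = 0" "\<forall>h. \<exists>a\<in>Hp. \<exists>b\<in>Hu. h = a + b"
      "V1 ` Hp \<subseteq> Hp" "V2 ` Hp \<subseteq> Hp" "V1 ` Hu \<subseteq> Hu" "V2 ` Hu \<subseteq> Hu"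
    and W: "bij_betw W Hp hardy2"
      "\<forall>x\<in>Hp. W (V1 x) = mult_op (bcl_phi1 P U) (W x)"
      "\<forall>x\<in>Hp. W (V2 x) = mult_op (bcl_phi2 P U) (W x)"
    using bcl unfolding bcl_triple_def by (elim conjE exE) (rule that; assumption)
  have const: "\<exists>h\<in>Hp. W h 0 = e" for e
  proof -
    have "(\<lambda>z. if z \<in> ball 0 1 then e else 0) \<in> W ` Hp"
      using hardy2_const W(1) by (simp add: bij_betw_def)
    then obtain h where "h \<in> Hp" "W h = (\<lambda>z. if z \<in> ball 0 1 then e else 0)" by auto
    then show ?thesis by (intro bexI[of _ h]) auto
  qed
  have sub1: "\<exists>e'. bcl_phi1 P U 0 e = bcl_phi2 P U 0 e'" for e
  proof -
    obtain h where h: "h \<in> Hp" "W h 0 = e" using const by blast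
    obtain k where k: "k \<in> Hp" "V1 h = V2 k"
      using range_restrict_subset[OF V _ H(1,2,3,4,5,7) h(1)] ran by blast
    have "mult_op (bcl_phi1 P U) (W h) 0 = mult_op (bcl_phi2 P U) (W k) 0"
      using W(2,3) h(1) k by metis
    then show ?thesis using h(2) by (auto simp: mult_op_def)
  qed
  have sub2: "\<exists>e'. bcl_phi2 P U 0 e = bcl_phi1 P U 0 e'" for e
  proof -
    obtain h where h: "h \<in> Hp" "W h 0 = e" using const by blast
    obtain k where k: "k \<in> Hp" "V2 h = V1 k"
      using range_restrict_subset[OF V(2,1) _ H(1,2,3,5,4,6) h(1)] ran by blast
    have "mult_op (bcl_phi2 P U) (W h) 0 = mult_op (bcl_phi1 P U) (W k) 0"
      using W(2,3) h(1) k by metis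
    then show ?thesis using h(2) by (auto simp: mult_op_def)
  qed
  \<comment> \<open>The argument \<open>adj U x\<close> turns \<open>P U\<close> into
    \<open>P\<close>, so \<open>range P\<close> lies in the range of \<open>adj U (I - P)\<close>;
    hence \<open>U\<close> sends it into the complement.\<close>
  have PUP: "P (U (P x)) = 0" for x
  proof -
    obtain e' where "bcl_phi2 P U 0 (adj U x) = bcl_phi1 P U 0 e'" using sub2 by blast
    then have "P x = adj U (e' - P e')" by (simp add: bcl_phi1_def bcl_phi2_def adj(2))
    then have "U (P x) = e' - P e'" by (simp add: adj(2))
    then show ?thesis by (simp add: P_simps)
  qed
  have adj_fix: "P (adj U (y - P y)) = adj U (y - P y)" for y
  proof -
    obtain e' where "bcl_phi1 P U 0 y = bcl_phi2 P U 0 e'" using sub1 by blast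
    then have "adj U (y - P y) = P (U e')" by (simp add: bcl_phi1_def bcl_phi2_def)
    then show ?thesis by (simp add: P_simps)
  qed
  have cinner_adj: "cinner y (U x) = cinner (adj U y) x" for x y
    by (metis U_simps(6) adj(2))
  have "P (U (x - P x)) = U (x - P x)" for x
  proof -
    define v where "v = U (x - P x)"
    \<comment> \<open>Moving \<open>U\<close> across the inner product leaves
      \<open>adj U (y - P y)\<close>, which lies in \<open>range P\<close>, against
      \<open>x - P x\<close>.\<close>
    have "cinner y (v - P v) = 0" for y
    proof -
      have "cinner y (v - P v) = cinner (y - P y) v"
        by (simp add: cinner_simps P_simps)
      also have "\<dots> = cinner (P (adj U (y - P y))) (x - P x)"
        by (simp only: v_def cinner_adj adj_fix)
      also have "\<dots> = 0" by (rule P_simps(6))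
      finally show ?thesis .
    qed
    then have "v - P v = 0" by (intro cinner_eqI) simp
    then show ?thesis by (simp add: v_def)
  qed
  moreover have "P (U x) = P (U (x - P x)) + P (U (P x))" for x
    by (simp add: U_simps P_simps)
  ultimately have "P (U x) = U (x - P x)" for x by (metis PUP add.right_neutral)
  then show ?thesis using P U by unfold_locales
qed

text \<open>Over a zero coefficient space the Hardy space is a point and \<open>Hp\<close> is zero;
  both isometries are then onto and the adjoint of their product is injective. Its contrapositive
  yields a nonzero vector.\<close>

lemma bcl_triple_trivial_space:
  assumes V: "isometry_op V1" "isometry_op V2"
    and bcl: "bcl_triple V1 V2 P (U :: 'e::chilbert_space \<Rightarrow> 'e)"
    and triv: "\<And>x::'e. x = 0"
  shows "kernel_op (adj (V1 \<circ> V2)) = {0}"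
proof -
  obtain Hp Hu and W :: "'a \<Rightarrow> complex \<Rightarrow> 'e" where
    H: "closed_subspace Hp" "\<forall>h. \<exists>a\<in>Hp. \<exists>b\<in>Hu. h = a + b"
    and bij: "bij_betw V1 Hu Hu" "bij_betw V2 Hu Hu" and W: "bij_betw W Hp hardy2"
    using bcl unfolding bcl_triple_def by (elim conjE exE) (rule that; assumption)
  have "W x = W y" for x y by (rule ext) (metis triv)
  then have "x = 0" if "x \<in> Hp" for x
    using W that closed_subspace_zero[OF H(1)] by (meson bij_betw_imp_inj_on inj_onD)
  then have "h \<in> Hu" for h using H(2) by (metis add_0)
  then have "Hu = UNIV" by blast
  then have "surj V1" "surj V2" using bij by (auto simp: bij_betw_def)
  then have surj: "surj (V1 \<circ> V2)" by (rule comp_surj[rotated])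
  have "(\<lambda>x. V1 (V2 x)) = V1 \<circ> V2" by auto
  then have "bounded_op (V1 \<circ> V2)"
    using isometry_op_compose[OF V] by (simp add: isometry_op_def)
  note adj = cinner_adj[OF this]
  have "k = 0" if "adj (V1 \<circ> V2) k = 0" for k
  proof -
    obtain x where "(V1 \<circ> V2) x = k" using surj by (metis surjD)
    then have "cinner k k = 0" using adj[of x k] that by simp
    then show ?thesis by (simp add: cinner_eq_zero_iff)
  qed
  moreover have "adj (V1 \<circ> V2) 0 = 0" by (rule adj_eqI) simp
  ultimately show ?thesis by (auto simp: kernel_op_def)
qed

lemma (in bcl_swap) range_P_nontrivial:
  assumes "(x::'e) \<noteq> 0"
  shows "range P \<noteq> {0}"
proof
  assume "range P = {0}"
  then have P0: "P y = 0" for y by blast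
  have "norm x = norm (P (U x))" by (simp add: swap U_simps(5) P0[of x])
  then show False using P0 assms by simp
qed

text \<open>For \<open>\<mu> = exp (\<i> * \<theta>)\<close> the number
  \<open>w * exp (\<i> * \<theta> / 2)\<close> is a square root of \<open>z\<close>. The angle is
  determined modulo 2 pi only, and a shift by 2 pi changes the sign of both coordinates, which
  \<open>s\<close> absorbs.\<close>

lemma square_roots_parametrization:
  fixes z :: complex
  assumes S: "\<And>\<mu>. \<mu> \<in> S \<Longrightarrow> cmod \<mu> = 1"
  shows "{(w, w * \<mu>) | w \<mu>. \<mu> \<in> S \<and> z = w * w * \<mu>}
    = {(s * csqrt z * exp (- \<i> * of_real \<theta> / 2), s * csqrt z * exp (\<i> * of_real \<theta> / 2)) | s \<theta>.
         s \<in> {1, -1} \<and> exp (\<i> * of_real \<theta>) \<in> S}" (is "?L = ?R")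
proof -
  have half: "exp (\<i> * of_real \<theta>) = exp (\<i> * of_real \<theta> / 2) * exp (\<i> * of_real \<theta> / 2)"
    and inv: "exp (- \<i> * of_real \<theta> / 2) * exp (\<i> * of_real \<theta> / 2) = 1" for \<theta> :: real
    by (simp_all flip: exp_add)
  show ?thesis
  proof (intro equalityI subsetI)
    fix l assume "l \<in> ?L"
    then obtain w \<mu> where l: "l = (w, w * \<mu>)" "\<mu> \<in> S" "z = w * w * \<mu>" by blast
    obtain \<theta> where \<theta>: "\<mu> = exp (\<i> * of_real \<theta>)"
      using S[OF l(2)] complex_norm_eq_1_exp by metis
    define e where "e = exp (\<i> * of_real \<theta> / 2)"
    define e' where "e' = exp (- \<i> * of_real \<theta> / 2)"
    have e: "\<mu> = e * e" "e' * e = 1" using half inv \<theta> by (simp_all add: e_def e'_def)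
    have "(csqrt z)\<^sup>2 = (w * e)\<^sup>2"
      unfolding power2_csqrt l(3) e(1) by (simp add: power2_eq_square mult_ac)
    then have "csqrt z = w * e \<or> csqrt z = - (w * e)" by (rule power2_eq_iff[THEN iffD1])
    then obtain s :: complex where s: "s \<in> {1, -1}" "w * e = s * csqrt z" by force
    have "w = s * csqrt z * e'" using s(2) e(2) by (metis mult.assoc mult.commute mult.right_neutral)
    moreover have "w * \<mu> = s * csqrt z * e" using s(2) e(1) by (metis mult.assoc)
    ultimately show "l \<in> ?R" using l s(1) \<theta> unfolding e_def e'_def by blast
  next
    fix l assume "l \<in> ?R"
    then obtain s \<theta> where l: "s \<in> {1, -1}" "exp (\<i> * of_real \<theta>) \<in> S"
      "l = (s * csqrt z * exp (- \<i> * of_real \<theta> / 2), s * csqrt z * exp (\<i> * of_real \<theta> / 2))" by blast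
    define e where "e = exp (\<i> * of_real \<theta> / 2)"
    define e' where "e' = exp (- \<i> * of_real \<theta> / 2)"
    have e: "exp (\<i> * of_real \<theta>) = e * e" "e' * e = 1" using half inv by (simp_all add: e_def e'_def)
    define w where "w = s * csqrt z * e'"
    have "w * (e * e) = s * csqrt z * e * (e' * e)" by (simp add: w_def mult_ac)
    then have we: "w * (e * e) = s * csqrt z * e" by (simp add: e(2))
    have "w * w * (e * e) = (s * s) * (csqrt z)\<^sup>2 * ((e' * e) * (e' * e))"
      by (simp add: w_def power2_eq_square mult_ac del: power2_csqrt)
    then have "z = w * w * (e * e)" using l(1) e(2) by auto
    moreover have "l = (w, w * (e * e))" by (simp only: l(3) we) (simp only: w_def e_def e'_def)
    moreover have "e * e \<in> S" using l(2) e(1) by simp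
    ultimately show "l \<in> ?L" by blast
  qed
qed

lemma unimodular_parametrization:
  assumes S: "\<And>\<mu>. \<mu> \<in> S \<Longrightarrow> cmod \<mu> = 1"
  shows "{(w, w * \<mu>) | w \<mu>. w \<in> cball 0 1 \<and> \<mu> \<in> S}
    = {(w, w * exp (\<i> * of_real \<theta>)) | w \<theta>. w \<in> cball 0 1 \<and> exp (\<i> * of_real \<theta>) \<in> S}"
proof -
  have "\<exists>\<theta>. \<mu> = exp (\<i> * of_real \<theta>)" if "\<mu> \<in> S" for \<mu>
    using S[OF that] complex_norm_eq_1_exp by metis
  then show ?thesis by blast
qed

theorem theorem5p8:
  fixes V1 V2 :: "'h::chilbert_space \<Rightarrow> 'h"
    and P U :: "'e::chilbert_space \<Rightarrow> 'e"
  assumes "isometry_op V1" and "isometry_op V2" and "V1 \<circ> V2 = V2 \<circ> V1"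
    and "range V1 = range V2"
    and "kernel_op (adj (V1 \<circ> V2)) \<noteq> {0}"
    and "bcl_triple V1 V2 P U"
  defines "\<sigma>U1U2 \<equiv> op_spectrum (range P) (\<lambda>y. U (U y))"
  shows
    "(\<forall>z\<in>ball 0 1.
        taylor_spectrum UNIV scaleC (bcl_phi1 P U z) (bcl_phi2 P U z) =
          {(s * csqrt z * exp (- \<i> * of_real \<theta> / 2), s * csqrt z * exp (\<i> * of_real \<theta> / 2)) | s \<theta>.
             s \<in> {1, -1} \<and> exp (\<i> * of_real \<theta>) \<in> \<sigma>U1U2})
     \<and> (\<forall>z\<in>ball 0 1. \<forall>l\<in>taylor_spectrum UNIV scaleC (bcl_phi1 P U z) (bcl_phi2 P U z).
          koszul_breaks_3 UNIV scaleC (bcl_phi1 P U z) (bcl_phi2 P U z) l)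
     \<and> taylor_spectrum hardy2 hardy_scale (mult_op (bcl_phi1 P U)) (mult_op (bcl_phi2 P U)) =
          closure (\<Union>z\<in>ball 0 1. taylor_spectrum UNIV scaleC (bcl_phi1 P U z) (bcl_phi2 P U z))
     \<and> closure (\<Union>z\<in>ball 0 1. taylor_spectrum UNIV scaleC (bcl_phi1 P U z) (bcl_phi2 P U z)) =
          {(w, w * exp (\<i> * of_real \<theta>)) | w \<theta>. w \<in> cball 0 1 \<and> exp (\<i> * of_real \<theta>) \<in> \<sigma>U1U2}
     \<and> (\<forall>w\<in>ball 0 1. \<forall>\<theta>::real. exp (\<i> * of_real \<theta>) \<in> \<sigma>U1U2 \<longrightarrow>
          koszul_breaks_3 hardy2 hardy_scale (mult_op (bcl_phi1 P U)) (mult_op (bcl_phi2 P U))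
            (w, w * exp (\<i> * of_real \<theta>)))"
proof -
  interpret bcl_swap P U
    using assms(1,2,4,6) by (rule bcl_triple_swap)
  obtain x :: 'e where "x \<noteq> 0"
    using bcl_triple_trivial_space[OF assms(1,2,6)] assms(5) by blast
  then have ne: "range P \<noteq> {0}" by (rule range_P_nontrivial)
  have \<sigma>: "\<sigma>U1U2 = \<sigma>W" by (simp add: \<sigma>U1U2_def)
  note uni = W.op_spectrum_norm
  show ?thesis
    unfolding \<sigma>
  proof (intro conjI ballI allI impI)
    fix z :: complex assume z: "z \<in> ball 0 1"
    show "taylor_spectrum UNIV scaleC (T1 z) (T2 z) =
        {(s * csqrt z * exp (- \<i> * of_real \<theta> / 2), s * csqrt z * exp (\<i> * of_real \<theta> / 2)) | s \<theta>.
           s \<in> {1, -1} \<and> exp (\<i> * of_real \<theta>) \<in> \<sigma>W}"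
      unfolding fibre_spectrum(1)[OF ne z] by (rule square_roots_parametrization[OF uni])
    show "koszul_breaks_3 UNIV scaleC (T1 z) (T2 z) l"
      if "l \<in> taylor_spectrum UNIV scaleC (T1 z) (T2 z)" for l
      using fibre_spectrum(2)[OF ne z that] .
  next
    show "taylor_spectrum hardy2 hardy_scale (mult_op T1) (mult_op T2)
        = closure (\<Union>z\<in>ball 0 1. taylor_spectrum UNIV scaleC (T1 z) (T2 z))"
      by (simp only: hardy_spectrum[OF ne] closure_fibre_spectra[OF ne])
    show "closure (\<Union>z\<in>ball 0 1. taylor_spectrum UNIV scaleC (T1 z) (T2 z)) =
        {(w, w * exp (\<i> * of_real \<theta>)) | w \<theta>. w \<in> cball 0 1 \<and> exp (\<i> * of_real \<theta>) \<in> \<sigma>W}"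
      unfolding closure_fibre_spectra[OF ne] by (rule unimodular_parametrization[OF uni])
  next
    fix w :: complex and \<theta> :: real
    assume "w \<in> ball 0 1" "exp (\<i> * of_real \<theta>) \<in> \<sigma>W"
    then show "koszul_breaks_3 hardy2 hardy_scale (mult_op T1) (mult_op T2) (w, w * exp (\<i> * of_real \<theta>))"
      using hardy_not_exact_3_interior by (simp add: koszul_breaks_3_def)
  qed
qed

end
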